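(* Let $(X,\mathcal{U})$ be a $T_0$ quasi-uniform space. Then $(X,\mathcal{U})$ has a $\tau$-completion; that is, its $\tau$-complement $(\overline{X},\overline{\mathcal{U}})$ is a $\tau$-complete quasi-uniform space.
   Context: A quasi-uniformity on a nonempty set $X$ is a filter $\mathcal{U}$ on $X\times X$ such that every $U\in\mathcal{U}$ contains the diagonal and for each $U\in\mathcal{U}$ there is $V\in\mathcal{U}$ with $V\circ V\subseteq U$. Put $\mathcal{U}^{-1}=\{U^{-1}: U\in\mathcal{U}\}$. The topology $\tau(\mathcal{U})$ has the sets $U(x)=\{y:(x,y)\in U\}$, $U\in\mathcal{U}$, as a neighborhood base at $x$. The space is $T_0$ if $\tau(\mathcal{U})$ is $T_0$. $\mathcal{U}_0$ denotes the base of $\mathcal{U}$ consisting of all $U\in\mathcal{U}$ that are $\tau(\mathcal{U}^{-1})\times\tau(\mathcal{U})$-open in $X\times X$. A net $(x_a)_{a\in A}$ in $X$ is a $\tau_p$-net (resp. $\tau_q$-net) if for every $W\in\mathcal{U}$ there is $a_W\in A$ with $(x_{a'},x_a)\in W$ (resp. $(x_a,x_{a'})\in W$) for all $a'\ge a\ge a_W$. For nets $(y_\beta)_{\beta\in B}$, $(x_a)_{a\in A}$ and $U\in\mathcal{U}$, write $\tau.((y_\beta)_\beta,(x_a)_a)\in U$ if there are $\beta_0\in B$, $a_0\in A$ with $(y_\beta,x_a)\in U$ for all $\beta\ge\beta_0$, $a\ge a_0$. The net $(y_\beta)$ is a conet of $(x_a)$ if $\tau.((y_\beta)_\beta,(x_a)_a)\in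 U$ for every $U\in\mathcal{U}$. A $\tau$-cut of $(X,\mathcal{U})$ is an ordered pair $\xi=(\mathcal{A}_\xi,\mathcal{B}_\xi)$ of nonempty families of $\tau_p$-nets and $\tau_q$-nets of $X$, respectively, such that (1) every member of $\mathcal{B}_\xi$ is a conet of every member of $\mathcal{A}_\xi$; (2) $\mathcal{B}_\xi$ contains all $\tau_q$-nets which are conets of all members of $\mathcal{A}_\xi$, and $\mathcal{A}_\xi$ contains all $\tau_p$-nets of which all members of $\mathcal{B}_\xi$ are conets. The members of $\mathcal{B}_\xi$ are called $\tau_q$-conets. A member of $\mathcal{A}_\xi$ (resp. $\mathcal{B}_\xi$) is said to converge to a point if it converges to it with respect to $\tau(\mathcal{U})$ (resp. $\tau(\mathcal{U}^{-1})$). A quasi-uniform space is $\tau$-complete if for every $\tau$-cut of it there is a point to which all members of both classes of the $\tau$-cut converge. $\overline{X}$ denotes the set of all $\tau$-cuts of $(X,\mathcal{U})$. For $W\in\mathcal{U}$, $\overline{W}\subseteq\overline{X}\times\overline{X}$ is the set of pairs $(\xi',\xi'')$ such that either (1) $\mathcal{A}_{\xi''}\subseteq\mathcal{A}_{\xi'}$, or (2) there is a $\tau_p$-net $(x_\beta)_{\beta\in B}\in\mathcal{A}_{\xi'}$ such that $\tau.((x_\beta)_\beta,(x_a)_a)\in W$ for every $(x_a)_{a\in A}\in\mathcal{A}_{\xi''}$. The quasi-uniformity $\overline{\mathcal{U}}$ on $\overline{X}$ is the one with base $\{\overline{W}: W\in\mathcal{U}_0\}$. The space $(\overline{X},\overline{\mathcal{U}})$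 is called the $\tau$-complement of $(X,\mathcal{U})$. *)

theory Defs
  imports "HOL-Analysis.Analysis"
begin

section \<open>Quasi-uniformities\<close>

definition quasi_uniformity :: "'a set \<Rightarrow> ('a \<times> 'a) set set \<Rightarrow> bool" where
  "quasi_uniformity X \<U> \<longleftrightarrow>
     X \<noteq> {} \<and>
     \<U> \<noteq> {} \<and>
     (\<forall>U\<in>\<U>. U \<subseteq> X \<times> X) \<and>
     (\<forall>U\<in>\<U>. \<forall>V. U \<subseteq> V \<and> V \<subseteq> X \<times> X \<longrightarrow> V \<in> \<U>) \<and>
     (\<forall>U\<in>\<U>. \<forall>V\<in>\<U>. U \<inter> V \<in> \<U>) \<and>
     (\<forall>U\<in>\<U>. Id_on X \<subseteq> U) \<and>
     (\<forall>U\<in>\<U>. \<exists>V\<in>\<U>. V O V \<subseteq> U)"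

definition conjugate :: "('a \<times> 'a) set set \<Rightarrow> ('a \<times> 'a) set set" where
  "conjugate \<U> = converse ` \<U>"

text \<open>
  The topology in which the sets \<open>U `` {x} = {y. (x, y) \<in> U}\<close> form a neighbourhood base at \<open>x\<close>;
  see \<open>openin_qu_topology\<close> and \<open>qu_topology_nbhd\<close> below.
\<close>

definition qu_topology :: "'a set \<Rightarrow> ('a \<times> 'a) set set \<Rightarrow> 'a topology" where
  "qu_topology X \<U> = topology (\<lambda>S. S \<subseteq> X \<and> (\<forall>x\<in>S. \<exists>U\<in>\<U>. U `` {x} \<subseteq> S))"

definition open_entourages :: "'a set \<Rightarrow> ('a \<times> 'a) set set \<Rightarrow> ('a \<times> 'a) set set" where
  "open_entourages X \<U> =
     {U \<in> \<U>. openin (prod_topology (qu_topology X (conjugate \<U>)) (qu_topology X \<U>)) U}"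

lemma quasi_uniformityD:
  assumes "quasi_uniformity X \<U>"
  shows "X \<noteq> {}" "\<U> \<noteq> {}"
    and "U \<in> \<U> \<Longrightarrow> U \<subseteq> X \<times> X"
    and "U \<in> \<U> \<Longrightarrow> U \<subseteq> V \<Longrightarrow> V \<subseteq> X \<times> X \<Longrightarrow> V \<in> \<U>"
    and "U \<in> \<U> \<Longrightarrow> V \<in> \<U> \<Longrightarrow> U \<inter> V \<in> \<U>"
    and "U \<in> \<U> \<Longrightarrow> Id_on X \<subseteq> U"
    and "U \<in> \<U> \<Longrightarrow> \<exists>V\<in>\<U>. V O V \<subseteq> U"
  using assms[unfolded quasi_uniformity_def] by (elim conjE, (assumption | meson))+

lemma openin_qu_topology:
  assumes "quasi_uniformity X \<U>"
  shows "openin (qu_topology X \<U>) S \<longleftrightarrow> S \<subseteq> X \<and> (\<forall>x\<in>S. \<exists>U\<in>\<U>. U `` {x} \<subseteq> S)"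
proof -
  have int: "\<exists>U\<in>\<U>. U `` {x} \<subseteq> S \<inter> T"
    if "U \<in> \<U>" "V \<in> \<U>" "U `` {x} \<subseteq> S" "V `` {x} \<subseteq> T" for U V S T x
  proof (rule bexI)
    show "(U \<inter> V) `` {x} \<subseteq> S \<inter> T" using that by blast
    show "U \<inter> V \<in> \<U>" using that quasi_uniformityD(5)[OF assms] by simp
  qed
  have "istopology (\<lambda>S. S \<subseteq> X \<and> (\<forall>x\<in>S. \<exists>U\<in>\<U>. U `` {x} \<subseteq> S))"
    unfolding istopology_def
  proof (intro conjI allI impI)
    fix S T
    assume S: "S \<subseteq> X \<and> (\<forall>x\<in>S. \<exists>U\<in>\<U>. U `` {x} \<subseteq> S)"
      and T: "T \<subseteq> X \<and> (\<forall>x\<in>T. \<exists>U\<in>\<U>. U `` {x} \<subseteq> T)"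
    show "S \<inter> T \<subseteq> X" using S by blast
    show "\<forall>x\<in>S \<inter> T. \<exists>U\<in>\<U>. U `` {x} \<subseteq> S \<inter> T"
    proof
      fix x assume "x \<in> S \<inter> T"
      then obtain U V where "U \<in> \<U>" "U `` {x} \<subseteq> S" "V \<in> \<U>" "V `` {x} \<subseteq> T"
        using S T by (meson IntD1 IntD2)
      then show "\<exists>U\<in>\<U>. U `` {x} \<subseteq> S \<inter> T" by (intro int)
    qed
  next
    fix K
    assume K: "\<forall>S\<in>K. S \<subseteq> X \<and> (\<forall>x\<in>S. \<exists>U\<in>\<U>. U `` {x} \<subseteq> S)"
    then show "\<Union>K \<subseteq> X" by blast
    show "\<forall>x\<in>\<Union>K. \<exists>U\<in>\<U>. U `` {x} \<subseteq> \<Union>K"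
    proof
      fix x assume "x \<in> \<Union>K"
      then obtain S where "S \<in> K" "x \<in> S" by blast
      with K show "\<exists>U\<in>\<U>. U `` {x} \<subseteq> \<Union>K" by (meson Union_upper order_trans)
    qed
  qed
  then show ?thesis
    by (simp add: qu_topology_def topology_inverse')
qed

lemma topspace_qu_topology:
  assumes "quasi_uniformity X \<U>"
  shows "topspace (qu_topology X \<U>) = X"
proof (rule antisym)
  show "topspace (qu_topology X \<U>) \<subseteq> X"
    by (metis assms openin_qu_topology openin_topspace)
  obtain U where "U \<in> \<U>" "U \<subseteq> X \<times> X"
    using quasi_uniformityD(2,3)[OF assms] by (metis ex_in_conv)
  then have "\<forall>x\<in>X. \<exists>U\<in>\<U>. U `` {x} \<subseteq> X" by blast
  then have "openin (qu_topology X \<U>) X"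
    using openin_qu_topology[OF assms] by blast
  then show "X \<subseteq> topspace (qu_topology X \<U>)" by (rule openin_subset)
qed

lemma quasi_uniformity_conjugate:
  assumes "quasi_uniformity X \<U>"
  shows "quasi_uniformity X (conjugate \<U>)"
proof -
  have up: "V \<in> conjugate \<U>" if "U \<in> \<U>" "U\<inverse> \<subseteq> V" "V \<subseteq> X \<times> X" for U V
  proof -
    have "U \<subseteq> V\<inverse>" "V\<inverse> \<subseteq> X \<times> X" using that by auto
    then have "V\<inverse> \<in> \<U>" using quasi_uniformityD(4)[OF assms that(1)] by simp
    then have "(V\<inverse>)\<inverse> \<in> conjugate \<U>" unfolding conjugate_def by (rule imageI)
    then show ?thesis by simp
  qed
  have inter: "U\<inverse> \<inter> V\<inverse> \<in> conjugate \<U>" if "U \<in> \<U>" "V \<in> \<U>" for U V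
  proof -
    have "U \<inter> V \<in> \<U>" using quasi_uniformityD(5)[OF assms] that by simp
    then have "(U \<inter> V)\<inverse> \<in> conjugate \<U>" unfolding conjugate_def by (rule imageI)
    then show ?thesis by (simp add: converse_Int)
  qed
  have comp: "\<exists>V\<in>conjugate \<U>. V O V \<subseteq> U\<inverse>" if U: "U \<in> \<U>" for U
  proof -
    obtain V where V: "V \<in> \<U>" "V O V \<subseteq> U"
      using quasi_uniformityD(7)[OF assms U] by blast
    have "V\<inverse> O V\<inverse> \<subseteq> U\<inverse>" using V(2) by auto
    then show ?thesis using V(1) unfolding conjugate_def by blast
  qed
  note basic = quasi_uniformityD(1,2,3,6)[OF assms]
  show ?thesis
    unfolding quasi_uniformity_def
  proof (intro conjI)
    show "X \<noteq> {}" by (rule basic(1))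
    show "conjugate \<U> \<noteq> {}" using basic(2) by (simp add: conjugate_def)
    show "\<forall>U\<in>conjugate \<U>. U \<subseteq> X \<times> X" using basic(3) by (fastforce simp: conjugate_def)
    show "\<forall>U\<in>conjugate \<U>. \<forall>V. U \<subseteq> V \<and> V \<subseteq> X \<times> X \<longrightarrow> V \<in> conjugate \<U>"
      using up unfolding conjugate_def ball_simps by blast
    show "\<forall>U\<in>conjugate \<U>. \<forall>V\<in>conjugate \<U>. U \<inter> V \<in> conjugate \<U>"
      using inter unfolding conjugate_def ball_simps by blast
    show "\<forall>U\<in>conjugate \<U>. Id_on X \<subseteq> U" using basic(4) by (fastforce simp: conjugate_def)
    show "\<forall>U\<in>conjugate \<U>. \<exists>V\<in>conjugate \<U>. V O V \<subseteq> U"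
      using comp unfolding conjugate_def ball_simps by blast
  qed
qed

lemma qu_topology_nbhd:
  assumes qu: "quasi_uniformity X \<U>" and x: "x \<in> X"
  shows "(\<exists>S. openin (qu_topology X \<U>) S \<and> x \<in> S \<and> S \<subseteq> N) \<longleftrightarrow> (\<exists>U\<in>\<U>. U `` {x} \<subseteq> N)"
proof
  assume "\<exists>S. openin (qu_topology X \<U>) S \<and> x \<in> S \<and> S \<subseteq> N"
  then show "\<exists>U\<in>\<U>. U `` {x} \<subseteq> N"
    using openin_qu_topology[OF qu] by (meson order_trans)
next
  assume ex: "\<exists>U\<in>\<U>. U `` {x} \<subseteq> N"
  define S where "S = {y \<in> X. \<exists>U\<in>\<U>. U `` {y} \<subseteq> N}"
  have "\<exists>V\<in>\<U>. V `` {y} \<subseteq> S" if y: "y \<in> S" for y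
  proof -
    obtain U where U: "U \<in> \<U>" "U `` {y} \<subseteq> N" using y by (auto simp: S_def)
    then obtain V where V: "V \<in> \<U>" "V O V \<subseteq> U"
      using quasi_uniformityD(7)[OF qu] by blast
    have VX: "V \<subseteq> X \<times> X" using V(1) quasi_uniformityD(3)[OF qu] by simp
    have "V `` {y} \<subseteq> S"
    proof
      fix z assume z: "z \<in> V `` {y}"
      then have "V `` {z} \<subseteq> N" using U V by blast
      then show "z \<in> S" using z V VX by (auto simp: S_def)
    qed
    then show ?thesis using V by blast
  qed
  then have "openin (qu_topology X \<U>) S"
    by (auto simp: openin_qu_topology[OF qu] S_def)
  moreover have "x \<in> S" using ex x by (simp add: S_def)
  moreover have "S \<subseteq> N"
  proof
    fix y assume "y \<in> S"
    then obtain U where U: "y \<in> X" "U \<in> \<U>" "U `` {y} \<subseteq> N" by (auto simp: S_def)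
    then have "(y, y) \<in> U" using quasi_uniformityD(6)[OF qu] by blast
    then show "y \<in> N" using U by blast
  qed
  ultimately show "\<exists>S. openin (qu_topology X \<U>) S \<and> x \<in> S \<and> S \<subseteq> N" by blast
qed


section \<open>Nets\<close>

text \<open>
  A net is a pair \<open>(r, x)\<close>: its index set is \<open>Field r\<close>, a subset of the type \<open>'i\<close>, and
  \<open>(a, a') \<in> r\<close> means \<open>a \<le> a'\<close>. Directed sets are preordered (antisymmetry is not required).
  The map \<open>x\<close> is extensional, so that two nets are equal as soon as they have the same index
  preorder and agree on it.
\<close>

type_synonym ('i, 'a) net = "('i \<times> 'i) set \<times> ('i \<Rightarrow> 'a)"

definition directed_preorder :: "('i \<times> 'i) set \<Rightarrow> bool" where
  "directed_preorder r \<longleftrightarrow>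
     Field r \<noteq> {} \<and> preorder_on (Field r) r \<and>
     (\<forall>a\<in>Field r. \<forall>b\<in>Field r. \<exists>c\<in>Field r. (a, c) \<in> r \<and> (b, c) \<in> r)"

definition net_in :: "'a set \<Rightarrow> ('i, 'a) net \<Rightarrow> bool" where
  "net_in X = (\<lambda>(r, x). directed_preorder r \<and> x \<in> Field r \<rightarrow>\<^sub>E X)"

definition net_filter :: "('i \<times> 'i) set \<Rightarrow> 'i filter" where
  "net_filter r = (INF a\<in>Field r. principal {a'. (a, a') \<in> r})"

definition net_converges :: "'a topology \<Rightarrow> ('i, 'a) net \<Rightarrow> 'a \<Rightarrow> bool" where
  "net_converges T = (\<lambda>(r, x) p. limitin T x p (net_filter r))"

lemma eventually_net_filter:
  assumes "directed_preorder r"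
  shows "eventually P (net_filter r) \<longleftrightarrow> (\<exists>a\<in>Field r. \<forall>a'. (a, a') \<in> r \<longrightarrow> P a')"
  unfolding net_filter_def
proof (subst eventually_INF_base)
  show "Field r \<noteq> {}" using assms by (simp add: directed_preorder_def)
  have tr: "trans r" using assms by (simp add: directed_preorder_def preorder_on_def)
  fix a b assume "a \<in> Field r" "b \<in> Field r"
  then obtain c where "c \<in> Field r" "(a, c) \<in> r" "(b, c) \<in> r"
    using assms unfolding directed_preorder_def by blast
  then show "\<exists>c\<in>Field r. principal {a'. (c, a') \<in> r}
      \<le> inf (principal {a'. (a, a') \<in> r}) (principal {a'. (b, a') \<in> r})"
    using tr by (auto dest: transD)
qed (auto simp: eventually_principal)

definition tau_p_net :: "'a set \<Rightarrow> ('a \<times> 'a) set set \<Rightarrow> ('i, 'a) net \<Rightarrow> bool" where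
  "tau_p_net X \<U> = (\<lambda>(r, x). net_in X (r, x) \<and>
     (\<forall>W\<in>\<U>. \<exists>a\<^sub>W\<in>Field r. \<forall>a a'. (a\<^sub>W, a) \<in> r \<and> (a, a') \<in> r \<longrightarrow> (x a', x a) \<in> W))"

definition tau_q_net :: "'a set \<Rightarrow> ('a \<times> 'a) set set \<Rightarrow> ('i, 'a) net \<Rightarrow> bool" where
  "tau_q_net X \<U> = (\<lambda>(r, x). net_in X (r, x) \<and>
     (\<forall>W\<in>\<U>. \<exists>a\<^sub>W\<in>Field r. \<forall>a a'. (a\<^sub>W, a) \<in> r \<and> (a, a') \<in> r \<longrightarrow> (x a, x a') \<in> W))"

definition tau_in :: "('i, 'a) net \<Rightarrow> ('j, 'a) net \<Rightarrow> ('a \<times> 'a) set \<Rightarrow> bool" where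
  "tau_in = (\<lambda>(s, y) (r, x) U. \<exists>b\<^sub>0\<in>Field s. \<exists>a\<^sub>0\<in>Field r.
     \<forall>b a. (b\<^sub>0, b) \<in> s \<and> (a\<^sub>0, a) \<in> r \<longrightarrow> (y b, x a) \<in> U)"

definition conet :: "('a \<times> 'a) set set \<Rightarrow> ('i, 'a) net \<Rightarrow> ('j, 'a) net \<Rightarrow> bool" where
  "conet \<U> M N \<longleftrightarrow> (\<forall>U\<in>\<U>. tau_in M N U)"


section \<open>Cuts, completeness and the complement\<close>

type_synonym ('i, 'a) cut = "('i, 'a) net set \<times> ('i, 'a) net set"

definition tau_cut :: "'a set \<Rightarrow> ('a \<times> 'a) set set \<Rightarrow> ('i, 'a) cut \<Rightarrow> bool" where
  "tau_cut X \<U> = (\<lambda>(\<A>, \<B>).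
     \<A> \<noteq> {} \<and> \<B> \<noteq> {} \<and>
     (\<forall>N\<in>\<A>. tau_p_net X \<U> N) \<and> (\<forall>M\<in>\<B>. tau_q_net X \<U> M) \<and>
     (\<forall>M\<in>\<B>. \<forall>N\<in>\<A>. conet \<U> M N) \<and>
     (\<forall>M. tau_q_net X \<U> M \<and> (\<forall>N\<in>\<A>. conet \<U> M N) \<longrightarrow> M \<in> \<B>) \<and>
     (\<forall>N. tau_p_net X \<U> N \<and> (\<forall>M\<in>\<B>. conet \<U> M N) \<longrightarrow> N \<in> \<A>))"

text \<open>
  Nets over all directed sets form a proper class, so completeness is relative to the type \<open>'j\<close>
  from which the index sets are taken. Requiring it for every type \<open>'j\<close> amounts to admitting
  arbitrary directed sets.
\<close>

definition tau_complete :: "'j itself \<Rightarrow> 'a set \<Rightarrow> ('a \<times> 'a) set set \<Rightarrow> bool" where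
  "tau_complete _ X \<U> \<longleftrightarrow>
     (\<forall>\<A> \<B> :: ('j, 'a) net set. tau_cut X \<U> (\<A>, \<B>) \<longrightarrow>
        (\<exists>p\<in>X. (\<forall>N\<in>\<A>. net_converges (qu_topology X \<U>) N p) \<and>
               (\<forall>M\<in>\<B>. net_converges (qu_topology X (conjugate \<U>)) M p)))"

definition tau_cuts :: "'a set \<Rightarrow> ('a \<times> 'a) set set \<Rightarrow> ('i, 'a) cut set" where
  "tau_cuts X \<U> = {\<xi>. tau_cut X \<U> \<xi>}"

definition cut_entourage ::
    "'a set \<Rightarrow> ('a \<times> 'a) set set \<Rightarrow> ('a \<times> 'a) set \<Rightarrow> (('i, 'a) cut \<times> ('i, 'a) cut) set" where
  "cut_entourage X \<U> W =
     {(\<xi>', \<xi>''). \<xi>' \<in> tau_cuts X \<U> \<and> \<xi>'' \<in> tau_cuts X \<U> \<and>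
        (fst \<xi>'' \<subseteq> fst \<xi>' \<or> (\<exists>M\<in>fst \<xi>'. \<forall>N\<in>fst \<xi>''. tau_in M N W))}"

definition cut_uniformity ::
    "'a set \<Rightarrow> ('a \<times> 'a) set set \<Rightarrow> (('i, 'a) cut \<times> ('i, 'a) cut) set set" where
  "cut_uniformity X \<U> =
     {S. S \<subseteq> tau_cuts X \<U> \<times> tau_cuts X \<U> \<and>
         (\<exists>W\<in>open_entourages X \<U>. cut_entourage X \<U> W \<subseteq> S)}"

text \<open>
  A \<open>\<tau>\<close>-cut enters the constructions above only through the tail filters of its nets, and every
  \<open>\<tau>\<^sub>p\<close>- or \<open>\<tau>\<^sub>q\<close>-net in a set \<open>X :: 'a set\<close> has the same tail filter as one of the same kind whose
  index set is a subset of its own with at most \<open>max \<aleph>\<^sub>0 (2 ^ \<bar>'a \<times> 'a\<bar>)\<close> elements. Hence nets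
  indexed in a type \<open>'i\<close> of at least this size stand for all nets in \<open>X\<close>.
\<close>

definition large_index_type :: "'i itself \<Rightarrow> 'a itself \<Rightarrow> bool" where
  "large_index_type _ _ \<longleftrightarrow> (\<exists>f :: ('a \<times> 'a) set \<times> nat \<Rightarrow> 'i. inj f)"

end

theory Submission
  imports Defs "HOL-Algebra.Free_Abelian_Groups"
begin

text \<open>
  Read \<open>(x, y) \<in> W\<close> as ``\<open>x\<close> lies above \<open>y\<close> up to \<open>W\<close>''. Then a \<open>\<tau>\<^sub>p\<close>-net increases, a
  \<open>\<tau>\<^sub>q\<close>-net decreases, a conet lies above the net it belongs to, and a cut
  \<open>\<xi> = (\<A>\<^sub>\<xi>, \<B>\<^sub>\<xi>)\<close> is a Dedekind cut with increasing nets below it and decreasing nets above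
  it. That the entourages of cuts compose, which makes the complement a quasi-uniform space, is
  proved by looking at the two alternatives in their definition.

  The complement is complete because both kinds of Cauchy net of cuts have limits in \<open>X\<close> itself. A
  pair in the entourage of \<open>W\<close> is either an inclusion of lower classes or a domination: one net of
  the larger cut lies, up to \<open>W\<close>, above all lower nets of the smaller one. Hence along a Cauchy net
  of cuts \<open>(\<xi>\<^sub>a)\<close> there are two possibilities.

  \<^item> From some index on, domination by a fixed entourage never happens. Then the cuts are
    eventually monotone with respect to inclusion, and the nets that belong to the late cuts
    already are limits.

  \<^item> Domination happens arbitrarily late for each entourage. Two dominations in a row leave room
    for a point of \<open>X\<close> between the two outer cuts (\<open>interpolating_point\<close>), because a member
    of the first net that is late enough for the second one can be fixed once and for all. These
    points form a net in \<open>X\<close> which has the monotonicity of \<open>(\<xi>\<^sub>a)\<close> and stays close to it (\<open>diagonal_q_net\<close>).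

  This gives \<open>p_limits_of_cut_net\<close> and \<open>q_limits_of_cut_net\<close>. Given a cut of the complement, the
  limits of its \<open>\<tau>\<^sub>q\<close>-nets are conets of the limits of its \<open>\<tau>\<^sub>p\<close>-nets (\<open>conet_limits\<close>), so the
  latter generate a cut of \<open>X\<close> by Galois closure. All nets of the given cut converge to it.

  The nets of the given cut have index sets in an arbitrary type, while the nets in \<open>X\<close> that make up
  a point of the complement are indexed in one fixed large type. For this reason the diagonal
  net is rebuilt in \<open>small_q_net\<close> over the finite sets of labels, where a label is a relation on
  the points: there are few enough labels to fit into the index type and enough of them to name
  every entourage and every subset of \<open>X\<close> that contains a tail.
\<close>

section \<open>Tail filters\<close>

definition tail_filter :: "('i, 'a) net \<Rightarrow> 'a filter" where
  "tail_filter = (\<lambda>(r, x). filtermap x (net_filter r))"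

lemma eventually_tail_filter:
  assumes "net_in X (r, x)"
  shows "eventually P (tail_filter (r, x)) \<longleftrightarrow> (\<exists>a\<in>Field r. \<forall>a'. (a, a') \<in> r \<longrightarrow> P (x a'))"
  using assms by (simp add: tail_filter_def eventually_filtermap eventually_net_filter net_in_def)

lemma directed_preorder_refl: "directed_preorder r \<Longrightarrow> a \<in> Field r \<Longrightarrow> (a, a) \<in> r"
  by (simp add: directed_preorder_def preorder_on_def refl_on_def)

lemma directed_preorder_trans:
  "directed_preorder r \<Longrightarrow> (a, b) \<in> r \<Longrightarrow> (b, c) \<in> r \<Longrightarrow> (a, c) \<in> r"
  unfolding directed_preorder_def preorder_on_def by (meson transD)

lemma directed_preorder_upper_bound:
  assumes "directed_preorder r" "a \<in> Field r" "b \<in> Field r"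
  obtains c where "c \<in> Field r" "(a, c) \<in> r" "(b, c) \<in> r"
  using assms unfolding directed_preorder_def by blast

lemma net_in_value: "net_in X (r, x) \<Longrightarrow> a \<in> Field r \<Longrightarrow> x a \<in> X"
  by (auto simp: net_in_def)

lemma net_in_directed: "net_in X (r, x) \<Longrightarrow> directed_preorder r"
  by (simp add: net_in_def)

lemma tail_filter_neq_bot:
  assumes "net_in X N"
  shows "tail_filter N \<noteq> bot"
proof -
  obtain r x where N: "N = (r, x)" by (cases N)
  have net: "net_in X (r, x)" using assms N by simp
  have "(a, a) \<in> r" if "a \<in> Field r" for a
    using net_in_directed[OF net] that by (rule directed_preorder_refl)
  then have "\<not> eventually (\<lambda>_. False) (tail_filter N)"
    unfolding N eventually_tail_filter[OF net] by blast
  then show ?thesis by (metis eventually_bot)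
qed

text \<open>
  The condition \<open>tau_in\<close> asks for tails that work for both nets at once. This is membership in the
  product filter, and stronger than the iterated form \<open>tau_in_eventually_eventually\<close>, in which the
  tail of the second net may depend on the member of the first.
\<close>

lemma tau_in_iff_eventually:
  assumes "net_in X M" "net_in Y N"
  shows "tau_in M N U \<longleftrightarrow> (\<forall>\<^sub>F z in tail_filter M \<times>\<^sub>F tail_filter N. z \<in> U)"
proof -
  obtain s y r x where [simp]: "M = (s, y)" "N = (r, x)" by (cases M, cases N)
  show ?thesis
  proof
    assume "tau_in M N U"
    then obtain b a where ba: "b \<in> Field s" "a \<in> Field r"
      and U: "\<And>b' a'. (b, b') \<in> s \<Longrightarrow> (a, a') \<in> r \<Longrightarrow> (y b', x a') \<in> U"
      by (auto simp: tau_in_def)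
    have "\<forall>\<^sub>F u in tail_filter M. \<exists>b'. (b, b') \<in> s \<and> u = y b'"
      "\<forall>\<^sub>F v in tail_filter N. \<exists>a'. (a, a') \<in> r \<and> v = x a'"
      using assms ba by (auto simp: eventually_tail_filter)
    then show "\<forall>\<^sub>F z in tail_filter M \<times>\<^sub>F tail_filter N. z \<in> U"
      unfolding eventually_prod_filter using U by blast
  next
    assume "\<forall>\<^sub>F z in tail_filter M \<times>\<^sub>F tail_filter N. z \<in> U"
    then obtain P Q where "eventually P (tail_filter M)" "eventually Q (tail_filter N)"
      and PQ: "\<And>u v. P u \<Longrightarrow> Q v \<Longrightarrow> (u, v) \<in> U"
      unfolding eventually_prod_filter by blast
    then obtain b a where "b \<in> Field s" "a \<in> Field r"
      "\<And>b'. (b, b') \<in> s \<Longrightarrow> P (y b')" "\<And>a'. (a, a') \<in> r \<Longrightarrow> Q (x a')"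
      using assms by (auto simp: eventually_tail_filter)
    then have "\<exists>b\<in>Field s. \<exists>a\<in>Field r. \<forall>b' a'. (b, b') \<in> s \<and> (a, a') \<in> r \<longrightarrow> (y b', x a') \<in> U"
      using PQ by blast
    then show "tau_in M N U" by (simp add: tau_in_def)
  qed
qed

lemma tau_p_net_iff_conjugate: "tau_p_net X \<U> N \<longleftrightarrow> tau_q_net X (conjugate \<U>) N"
  by (cases N) (simp add: tau_p_net_def tau_q_net_def conjugate_def)

lemma tau_p_net_net_in: "tau_p_net X \<U> N \<Longrightarrow> net_in X N"
  by (cases N) (simp add: tau_p_net_def)

lemma tau_q_net_net_in: "tau_q_net X \<U> N \<Longrightarrow> net_in X N"
  by (cases N) (simp add: tau_q_net_def)

lemma eventually_tail_filter_in:
  assumes "net_in X N"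
  shows "\<forall>\<^sub>F x in tail_filter N. x \<in> X"
proof -
  obtain r x where N: "N = (r, x)" by (cases N)
  have net: "net_in X (r, x)" using assms N by simp
  obtain a where "a \<in> Field r" using net_in_directed[OF net] by (auto simp: directed_preorder_def)
  then show ?thesis
    unfolding N eventually_tail_filter[OF net] using net_in_value[OF net FieldI2] by blast
qed

text \<open>
  Late members of a \<open>\<tau>\<^sub>q\<close>-net are only related to still later ones, so the nested form cannot be
  replaced by the product filter: the net is monotone up to \<open>W\<close>, not Cauchy in the symmetric sense.
\<close>

lemma eventually_tail_q_net:
  assumes "tau_q_net X \<U> M" "W \<in> \<U>"
  shows "\<forall>\<^sub>F x in tail_filter M. x \<in> X \<and> (\<forall>\<^sub>F y in tail_filter M. (x, y) \<in> W)"
proof -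
  obtain r x where M: "M = (r, x)" by (cases M)
  have n: "net_in X (r, x)" using tau_q_net_net_in[OF assms(1)] M by simp
  obtain a where "a \<in> Field r" "\<And>b c. (a, b) \<in> r \<Longrightarrow> (b, c) \<in> r \<Longrightarrow> (x b, x c) \<in> W"
    using assms by (auto simp: M tau_q_net_def)
  then show ?thesis
    unfolding M eventually_tail_filter[OF n] using net_in_value[OF n] by (meson FieldI2)
qed

lemma eventually_tail_p_net:
  assumes "tau_p_net X \<U> N" "W \<in> \<U>"
  shows "\<forall>\<^sub>F x in tail_filter N. x \<in> X \<and> (\<forall>\<^sub>F y in tail_filter N. (y, x) \<in> W)"
  using eventually_tail_q_net[of X "conjugate \<U>" N "W\<inverse>"] assms
  by (simp add: tau_p_net_iff_conjugate conjugate_def)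

lemma net_convergesI:
  assumes qu: "quasi_uniformity Y \<V>" and p: "p \<in> Y"
    and ev: "\<And>V. V \<in> \<V> \<Longrightarrow> \<forall>\<^sub>F y in tail_filter N. (p, y) \<in> V"
  shows "net_converges (qu_topology Y \<V>) N p"
proof -
  obtain r x where N: "N = (r, x)" by (cases N)
  have "eventually (\<lambda>a. x a \<in> S) (net_filter r)" if "openin (qu_topology Y \<V>) S" "p \<in> S" for S
  proof -
    obtain V where V: "V \<in> \<V>" "V `` {p} \<subseteq> S"
      using \<open>openin (qu_topology Y \<V>) S\<close> \<open>p \<in> S\<close> by (auto simp: openin_qu_topology[OF qu])
    show ?thesis
      using ev[OF V(1)] V(2)
      by (auto simp: N tail_filter_def eventually_filtermap elim!: eventually_mono)
  qed
  then show ?thesis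
    using p by (simp add: N net_converges_def limitin_def topspace_qu_topology[OF qu])
qed

section \<open>Small diagonal nets\<close>

text \<open>
  The factor \<open>nat\<close> makes the set of labels infinite even when \<open>'a\<close> is finite, and an infinite set
  has no more finite subsets than elements.
\<close>

lemma ex_inj_finite_sets:
  assumes "large_index_type TYPE('i) TYPE('a)"
  shows "\<exists>e :: (('a \<times> 'a) set \<times> nat) set \<Rightarrow> 'i. inj_on e (Fpow UNIV)"
proof -
  obtain f :: "('a \<times> 'a) set \<times> nat \<Rightarrow> 'i" where f: "inj f"
    using assms by (auto simp: large_index_type_def)
  have "infinite (UNIV :: (('a \<times> 'a) set \<times> nat) set)"
    by (simp add: finite_prod)
  then have "Fpow (UNIV :: (('a \<times> 'a) set \<times> nat) set) \<lesssim> (UNIV :: (('a \<times> 'a) set \<times> nat) set)"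
    by (intro eqpoll_imp_lepoll eqpoll_Fpow)
  then obtain g where "inj_on g (Fpow (UNIV :: (('a \<times> 'a) set \<times> nat) set))"
    "g ` Fpow (UNIV :: (('a \<times> 'a) set \<times> nat) set) \<subseteq> (UNIV :: (('a \<times> 'a) set \<times> nat) set)"
    unfolding lepoll_def by blast
  then have "inj_on (f \<circ> g) (Fpow UNIV)"
    using f by (intro comp_inj_on) (auto intro: inj_on_subset)
  then show ?thesis by blast
qed

text \<open>
  By recursion on finite sets \<open>F\<close>: only finitely many elements, the values at the proper subsets of
  \<open>F\<close> and the thresholds of the members of \<open>F\<close>, have to be bounded at each step.
\<close>

lemma ex_monotone_selection:
  fixes t :: "'l \<Rightarrow> 'b"
  assumes ne: "I \<noteq> {}" and t: "\<And>z. t z \<in> I"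
    and tr: "\<And>i j k. i \<in> I \<Longrightarrow> j \<in> I \<Longrightarrow> k \<in> I \<Longrightarrow> lt i j \<Longrightarrow> lt j k \<Longrightarrow> lt i k"
    and ub: "\<And>i j. i \<in> I \<Longrightarrow> j \<in> I \<Longrightarrow> \<exists>k\<in>I. lt i k \<and> lt j k"
  shows "\<exists>g. \<forall>F. finite F \<longrightarrow> g F \<in> I \<and> (\<forall>G. G \<subset> F \<longrightarrow> lt (g G) (g F)) \<and> (\<forall>z\<in>F. lt (t z) (g F))"
proof -
  have fin: "\<exists>k\<in>I. \<forall>i\<in>J. lt i k" if "finite J" "J \<subseteq> I" for J
    using that
  proof (induction J)
    case empty
    then show ?case using ne by blast
  next
    case (insert i J)
    then obtain k where k: "k \<in> I" "\<forall>j\<in>J. lt j k" by blast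
    obtain l where l: "l \<in> I" "lt i l" "lt k l" using ub[of i k] insert.prems k(1) by blast
    have "lt j l" if "j \<in> J" for j
      using tr[of j k l] that k l insert.prems by blast
    then show ?case using l by blast
  qed
  let ?P = "\<lambda>g F u. finite F \<longrightarrow> u \<in> I \<and> (\<forall>G. G \<subset> F \<longrightarrow> lt (g G) u) \<and> (\<forall>z\<in>F. lt (t z) u)"
  have "\<exists>g :: 'l set \<Rightarrow> 'b. \<forall>F. ?P g F (g F)"
  proof (rule dependent_wf_choice[OF wf_finite_psubset])
    fix g h :: "'l set \<Rightarrow> 'b" and F u
    assume "\<And>G. (G, F) \<in> finite_psubset \<Longrightarrow> g G = h G"
    then have "\<And>G. finite F \<Longrightarrow> G \<subset> F \<Longrightarrow> g G = h G" by (simp add: finite_psubset_def)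
    then show "?P g F u = ?P h F u" by auto
  next
    fix F and g :: "'l set \<Rightarrow> 'b"
    assume IH: "\<And>G. (G, F) \<in> finite_psubset \<Longrightarrow> ?P g G (g G)"
    show "\<exists>u. ?P g F u"
    proof (cases "finite F")
      case True
      have "\<exists>k\<in>I. \<forall>i\<in>g ` {G. G \<subset> F} \<union> t ` F. lt i k"
      proof (rule fin)
        have "{G. G \<subset> F} \<subseteq> Pow F" by blast
        then show "finite (g ` {G. G \<subset> F} \<union> t ` F)"
          using True finite_subset by blast
        have "g G \<in> I" if "G \<subset> F" for G
          using IH[of G] that True finite_subset[of G F] by (auto simp: finite_psubset_def)
        then show "g ` {G. G \<subset> F} \<union> t ` F \<subseteq> I" using t by blast
      qed
      then show ?thesis by blast
    qed simp
  qed
  then show ?thesis .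
qed

text \<open>
  Replaces a Cauchy family over an arbitrary directed set by a \<open>\<tau>\<^sub>q\<close>-net with index set in the
  prescribed type and a tail filter at least as fine. Cofinality in the original index set is
  lost; instead the new net is driven past a threshold for every set that contains a tail.
  The relation \<open>lt\<close> is meant to be strict, such as ``far beyond'': in \<open>diagonal_q_net\<close> nothing is
  known about two points whose stages overlap.
\<close>

lemma small_q_net:
  fixes y :: "'b \<Rightarrow> 'a" and \<U> :: "('a \<times> 'a) set set"
  assumes large: "large_index_type TYPE('i) TYPE('a)"
    and qu: "quasi_uniformity X \<U>"
    and ne: "I \<noteq> {}" and y: "\<And>i. i \<in> I \<Longrightarrow> y i \<in> X"
    and tr: "\<And>i j k. i \<in> I \<Longrightarrow> j \<in> I \<Longrightarrow> k \<in> I \<Longrightarrow> lt i j \<Longrightarrow> lt j k \<Longrightarrow> lt i k"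
    and ub: "\<And>i j. i \<in> I \<Longrightarrow> j \<in> I \<Longrightarrow> \<exists>k\<in>I. lt i k \<and> lt j k"
    and cauchy: "\<And>W. W \<in> \<U> \<Longrightarrow>
      \<exists>i\<^sub>0\<in>I. \<forall>i\<in>I. \<forall>j\<in>I. lt i\<^sub>0 i \<longrightarrow> lt i j \<longrightarrow> (y i, y j) \<in> W"
  shows "\<exists>Q :: ('i, 'a) net. tau_q_net X \<U> Q \<and>
    (\<forall>S. (\<exists>i\<^sub>0\<in>I. \<forall>i\<in>I. lt i\<^sub>0 i \<longrightarrow> y i \<in> S) \<longrightarrow> (\<forall>\<^sub>F x in tail_filter Q. x \<in> S))"
proof -
  \<comment> \<open>A label \<open>Z\<close> does two jobs: it stands for the entourage \<open>Z\<close> and for the set of points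
    \<open>fst ` Z\<close>; every set \<open>S\<close> is obtained in this way from \<open>Id_on S\<close>.\<close>
  define good where "good Z i \<longleftrightarrow>
      (Z \<in> \<U> \<longrightarrow> (\<forall>j\<in>I. \<forall>k\<in>I. lt i j \<longrightarrow> lt j k \<longrightarrow> (y j, y k) \<in> Z)) \<and>
      ((\<exists>i\<^sub>0\<in>I. \<forall>i\<in>I. lt i\<^sub>0 i \<longrightarrow> y i \<in> fst ` Z) \<longrightarrow> (\<forall>j\<in>I. lt i j \<longrightarrow> y j \<in> fst ` Z))" for Z i
  have "\<exists>i\<in>I. good Z i" for Z
  proof -
    obtain i where i: "i \<in> I"
      "Z \<in> \<U> \<longrightarrow> (\<forall>j\<in>I. \<forall>k\<in>I. lt i j \<longrightarrow> lt j k \<longrightarrow> (y j, y k) \<in> Z)"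
      using cauchy[of Z] ne by blast
    obtain i' where i': "i' \<in> I"
      "(\<exists>i\<^sub>0\<in>I. \<forall>i\<in>I. lt i\<^sub>0 i \<longrightarrow> y i \<in> fst ` Z) \<longrightarrow> (\<forall>j\<in>I. lt i' j \<longrightarrow> y j \<in> fst ` Z)"
      using ne by blast
    obtain u where u: "u \<in> I" "lt i u" "lt i' u" using ub i(1) i'(1) by blast
    have "lt i j \<and> lt i' j" if "j \<in> I" "lt u j" for j
      using tr[OF i(1) u(1) that(1) u(2) that(2)] tr[OF i'(1) u(1) that(1) u(3) that(2)] by simp
    then have "good Z u" using i i' unfolding good_def by blast
    then show ?thesis using u by blast
  qed
  then obtain t where t: "\<And>Z. t Z \<in> I" "\<And>Z. good Z (t Z)" by metis
  have "\<exists>g :: (('a \<times> 'a) set \<times> nat) set \<Rightarrow> 'b. \<forall>F. finite F \<longrightarrow> g F \<in> I \<and>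
      (\<forall>G. G \<subset> F \<longrightarrow> lt (g G) (g F)) \<and> (\<forall>z\<in>F. lt (t (fst z)) (g F))"
  proof (rule ex_monotone_selection)
    show "I \<noteq> {}" by (rule ne)
    show "t (fst z) \<in> I" for z :: "('a \<times> 'a) set \<times> nat" by (rule t(1))
    show "lt i k" if "i \<in> I" "j \<in> I" "k \<in> I" "lt i j" "lt j k" for i j k
      using that by (rule tr)
    show "\<exists>k\<in>I. lt i k \<and> lt j k" if "i \<in> I" "j \<in> I" for i j
      using that by (rule ub)
  qed
  then obtain g :: "(('a \<times> 'a) set \<times> nat) set \<Rightarrow> 'b" where
    g_all: "\<forall>F. finite F \<longrightarrow> g F \<in> I \<and>
      (\<forall>G. G \<subset> F \<longrightarrow> lt (g G) (g F)) \<and> (\<forall>z\<in>F. lt (t (fst z)) (g F))"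
    by (rule exE)
  have g: "g F \<in> I" if "finite F" for F using g_all that by simp
  have g_mono: "lt (g G) (g F)" if "finite F" "G \<subset> F" for F G using g_all that by simp
  have g_above: "lt (t (fst z)) (g F)" if "finite F" "z \<in> F" for F z using g_all that by simp
  obtain e :: "(('a \<times> 'a) set \<times> nat) set \<Rightarrow> 'i" where e: "inj_on e (Fpow UNIV)"
    using ex_inj_finite_sets[OF large] by blast
  have e_eq: "e F = e G \<longleftrightarrow> F = G" if "finite F" "finite G" for F G
    using inj_on_eq_iff[OF e] that by (simp add: Fpow_def)
  define r where "r = {(e G, e F) | G F. G \<subseteq> F \<and> finite F}"
  define q where "q = (\<lambda>i\<in>Field r. y (g (the_inv_into (Fpow UNIV) e i)))"
  have r_iff: "(e G, i) \<in> r \<longleftrightarrow> (\<exists>F. i = e F \<and> finite F \<and> G \<subseteq> F)" if "finite G" for G i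
    using that e_eq finite_subset unfolding r_def by blast
  have Field_r: "Field r = e ` {F. finite F}"
    unfolding r_def Field_def by (auto dest: finite_subset)
  have q: "q (e F) = y (g F)" if "finite F" for F
    using that the_inv_into_f_f[OF e, of F] by (simp add: q_def Field_r) (simp add: Fpow_def)
  have dir: "directed_preorder r"
    unfolding directed_preorder_def preorder_on_def
  proof (intro conjI)
    show "Field r \<noteq> {}" by (auto simp: Field_r)
    show "r \<subseteq> Field r \<times> Field r" by (auto simp: Field_def)
    show "refl_on (Field r) r" by (auto simp: refl_on_def Field_r r_iff)
    show "trans r"
    proof (rule transI)
      fix a b c assume ab: "(a, b) \<in> r" and bc: "(b, c) \<in> r"
      obtain G F where GF: "a = e G" "b = e F" "G \<subseteq> F" "finite F" using ab by (auto simp: r_def)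
      then obtain H where "c = e H" "finite H" "F \<subseteq> H" using bc by (auto simp: r_iff)
      then show "(a, c) \<in> r" using GF finite_subset by (auto simp: r_def)
    qed
    show "\<forall>a\<in>Field r. \<forall>b\<in>Field r. \<exists>c\<in>Field r. (a, c) \<in> r \<and> (b, c) \<in> r"
    proof (intro ballI)
      fix a b assume "a \<in> Field r" "b \<in> Field r"
      then obtain F G where "a = e F" "b = e G" "finite F" "finite G" by (auto simp: Field_r)
      then have "e (F \<union> G) \<in> Field r \<and> (a, e (F \<union> G)) \<in> r \<and> (b, e (F \<union> G)) \<in> r"
        by (auto simp: Field_r r_iff)
      then show "\<exists>c\<in>Field r. (a, c) \<in> r \<and> (b, c) \<in> r" by blast
    qed
  qed
  have "q i \<in> X" if "i \<in> Field r" for i using that q y g by (auto simp: Field_r)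
  then have net: "net_in X (r, q)"
    using dir by (auto simp: net_in_def q_def)
  have "tau_q_net X \<U> (r, q)"
    unfolding tau_q_net_def
  proof (simp add: net, intro ballI)
    fix W assume W: "W \<in> \<U>"
    have "(q a, q b) \<in> W" if a: "(e {(W, 0)}, a) \<in> r" and b: "(a, b) \<in> r" for a b
    proof -
      obtain F where F: "a = e F" "finite F" "(W, 0) \<in> F" using a by (auto simp: r_iff)
      obtain G where G: "b = e G" "finite G" "F \<subseteq> G" using b F by (auto simp: r_iff)
      show ?thesis
      proof (cases "F = G")
        case True
        \<comment> \<open>The index order is reflexive although \<open>lt\<close> need not be.\<close>
        then show ?thesis
          using quasi_uniformityD(6)[OF qu W] y[OF g[OF F(2)]] by (auto simp: F G q[OF G(2)])
      next
        case False
        then have "lt (g F) (g G)" using g_mono G by blast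
        moreover have "lt (t W) (g F)" using g_above[OF F(2,3)] by simp
        ultimately show ?thesis
          using t(2)[of W] W g F G by (auto simp: good_def q)
      qed
    qed
    then show "\<exists>a\<^sub>W\<in>Field r. \<forall>a a'. (a\<^sub>W, a) \<in> r \<and> (a, a') \<in> r \<longrightarrow> (q a, q a') \<in> W"
      by (intro bexI[of _ "e {(W, 0)}"]) (auto simp: Field_r)
  qed
  moreover have "\<forall>\<^sub>F x in tail_filter (r, q). x \<in> S"
    if S: "\<exists>i\<^sub>0\<in>I. \<forall>i\<in>I. lt i\<^sub>0 i \<longrightarrow> y i \<in> S" for S
  proof -
    have fst_S: "fst ` Id_on S = S" by force
    have "q a \<in> S" if a: "(e {(Id_on S, 0)}, a) \<in> r" for a
    proof -
      obtain F where F: "a = e F" "finite F" "(Id_on S, 0) \<in> F" using a by (auto simp: r_iff)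
      then show ?thesis
        using t(2)[of "Id_on S"] S g_above[OF F(2,3)] g[OF F(2)]
        unfolding good_def fst_S by (simp add: q)
    qed
    then show ?thesis
      unfolding eventually_tail_filter[OF net]
      by (intro bexI[of _ "e {(Id_on S, 0)}"]) (auto simp: Field_r)
  qed
  ultimately show ?thesis by blast
qed

text \<open>
  The relations \<open>L W x i\<close> and \<open>R W x j\<close> say that, up to \<open>W\<close>, the point \<open>x\<close> comes after stage \<open>i\<close>
  and before stage \<open>j\<close> of some net. Points squeezed between two stages form a \<open>\<tau>\<^sub>q\<close>-net if stages
  are skipped: \<open>x\<close> precedes \<open>y\<close> as soon as the upper stage of \<open>x\<close> comes before the lower stage of \<open>y\<close>.
  Stages are abstract here because the \<open>\<tau>\<^sub>p\<close>-case is the \<open>\<tau>\<^sub>q\<close>-case of the conjugate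
  quasi-uniformity, where points above and below a cut change roles.
\<close>

lemma diagonal_q_net:
  fixes L R :: "('a \<times> 'a) set \<Rightarrow> 'a \<Rightarrow> 'j \<Rightarrow> bool"
  assumes large: "large_index_type TYPE('i) TYPE('a)"
    and qu: "quasi_uniformity X \<U>"
    and dir: "directed_preorder r"
    and L_mono: "\<And>V W x i. V \<subseteq> W \<Longrightarrow> L V x i \<Longrightarrow> L W x i"
    and R_mono: "\<And>V W x i. V \<subseteq> W \<Longrightarrow> R V x i \<Longrightarrow> R W x i"
    and interp: "\<And>W i\<^sub>0. W \<in> \<U> \<Longrightarrow> i\<^sub>0 \<in> Field r \<Longrightarrow>
      \<exists>i j. \<exists>x\<in>X. (i\<^sub>0, i) \<in> r \<and> (i, j) \<in> r \<and> L W x i \<and> R W x j"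
    and cauchy: "\<And>W. W \<in> \<U> \<Longrightarrow> \<exists>V\<in>\<U>. \<exists>i\<^sub>0\<in>Field r. \<forall>i j x y.
      (i\<^sub>0, i) \<in> r \<longrightarrow> (i, j) \<in> r \<longrightarrow> R V x i \<longrightarrow> L V y j \<longrightarrow> (x, y) \<in> W"
  shows "\<exists>Q :: ('i, 'a) net. tau_q_net X \<U> Q \<and> (\<forall>i\<^sub>0\<in>Field r. \<forall>W\<in>\<U>.
    \<forall>\<^sub>F x in tail_filter Q. \<exists>i j. (i\<^sub>0, i) \<in> r \<and> (i, j) \<in> r \<and> L W x i \<and> R W x j)"
proof -
  have "\<forall>k\<in>Field r \<times> \<U>. \<exists>z. (fst k, fst z) \<in> r \<and> (fst z, fst (snd z)) \<in> r \<and> snd (snd z) \<in> X \<and>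
      L (snd k) (snd (snd z)) (fst z) \<and> R (snd k) (snd (snd z)) (fst (snd z))"
  proof
    fix k assume k: "k \<in> Field r \<times> \<U>"
    have kU: "snd k \<in> \<U>" and kr: "fst k \<in> Field r" using k by auto
    obtain i j x where "x \<in> X" "(fst k, i) \<in> r" "(i, j) \<in> r" "L (snd k) x i" "R (snd k) x j"
      using interp[OF kU kr] by blast
    then show "\<exists>z. (fst k, fst z) \<in> r \<and> (fst z, fst (snd z)) \<in> r \<and> snd (snd z) \<in> X \<and>
      L (snd k) (snd (snd z)) (fst z) \<and> R (snd k) (snd (snd z)) (fst (snd z))"
      by (intro exI[of _ "(i, j, x)"]) simp
  qed
  then obtain z where z: "\<And>k. k \<in> Field r \<times> \<U> \<Longrightarrow> (fst k, fst (z k)) \<in> r \<and>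
      (fst (z k), fst (snd (z k))) \<in> r \<and> snd (snd (z k)) \<in> X \<and>
      L (snd k) (snd (snd (z k))) (fst (z k)) \<and> R (snd k) (snd (snd (z k))) (fst (snd (z k)))"
    by metis
  \<comment> \<open>The index \<open>k = (i\<^sub>0, W)\<close> is served by a point \<open>y k\<close> between the stages \<open>lo k\<close> and \<open>hi k\<close>.\<close>
  define lo hi y where "lo k = fst (z k)" and "hi k = fst (snd (z k))" and "y k = snd (snd (z k))" for k
  have lo: "(fst k, lo k) \<in> r" and hi: "(lo k, hi k) \<in> r" and yX: "y k \<in> X"
    and yL: "L (snd k) (y k) (lo k)" and yR: "R (snd k) (y k) (hi k)" if "k \<in> Field r \<times> \<U>" for k
    using z[OF that] by (auto simp: lo_def hi_def y_def)
  note tr = directed_preorder_trans[OF dir]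
  define lt where "lt k l \<longleftrightarrow> (hi k, fst l) \<in> r \<and> snd l \<subseteq> snd k" for k l
  have fst_hi: "(fst k, hi k) \<in> r" if "k \<in> Field r \<times> \<U>" for k
    using tr lo hi that by blast
  have "\<exists>Q :: ('i, 'a) net. tau_q_net X \<U> Q \<and>
    (\<forall>S. (\<exists>k\<in>Field r \<times> \<U>. \<forall>l\<in>Field r \<times> \<U>. lt k l \<longrightarrow> y l \<in> S) \<longrightarrow>
      (\<forall>\<^sub>F x in tail_filter Q. x \<in> S))"
  proof (rule small_q_net[OF large qu])
    show "Field r \<times> \<U> \<noteq> {}"
      using dir quasi_uniformityD(2)[OF qu] by (auto simp: directed_preorder_def)
    show "y k \<in> X" if "k \<in> Field r \<times> \<U>" for k by (rule yX[OF that])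
    show "lt k m" if "k \<in> Field r \<times> \<U>" "l \<in> Field r \<times> \<U>" "m \<in> Field r \<times> \<U>" "lt k l" "lt l m" for k l m
    proof -
      have "(hi k, hi l) \<in> r" using tr fst_hi[OF that(2)] that(4) by (auto simp: lt_def)
      then show ?thesis using tr that(4,5) by (auto simp: lt_def)
    qed
    show "\<exists>m\<in>Field r \<times> \<U>. lt k m \<and> lt l m" if kl: "k \<in> Field r \<times> \<U>" "l \<in> Field r \<times> \<U>" for k l
    proof -
      obtain c where "c \<in> Field r" "(hi k, c) \<in> r" "(hi l, c) \<in> r"
        using directed_preorder_upper_bound[OF dir FieldI2[OF hi[OF kl(1)]] FieldI2[OF hi[OF kl(2)]]] .
      moreover have "snd k \<inter> snd l \<in> \<U>" using kl quasi_uniformityD(5)[OF qu] by auto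
      ultimately show ?thesis by (intro bexI[of _ "(c, snd k \<inter> snd l)"]) (auto simp: lt_def)
    qed
    fix W assume "W \<in> \<U>"
    then obtain V i where V: "V \<in> \<U>" "i \<in> Field r"
      "\<And>j k x y. (i, j) \<in> r \<Longrightarrow> (j, k) \<in> r \<Longrightarrow> R V x j \<Longrightarrow> L V y k \<Longrightarrow> (x, y) \<in> W"
      using cauchy by meson
    have "(y k, y l) \<in> W" if k: "k \<in> Field r \<times> \<U>" and l: "l \<in> Field r \<times> \<U>"
      and ik: "lt (i, V) k" and kl: "lt k l" for k l
    proof (rule V(3))
      have "(i, hi (i, V)) \<in> r" using fst_hi[of "(i, V)"] V by simp
      then show "(i, hi k) \<in> r"
        using ik tr fst_hi[OF k] unfolding lt_def by blast
      show "(hi k, lo l) \<in> r" using kl tr lo[OF l] unfolding lt_def by blast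
      show "R V (y k) (hi k)" using R_mono yR[OF k] ik by (auto simp: lt_def)
      show "L V (y l) (lo l)" using L_mono[OF _ yL[OF l]] ik kl by (auto simp: lt_def)
    qed
    then show "\<exists>k\<in>Field r \<times> \<U>. \<forall>l\<in>Field r \<times> \<U>. \<forall>m\<in>Field r \<times> \<U>.
        lt k l \<longrightarrow> lt l m \<longrightarrow> (y l, y m) \<in> W"
      using V by (intro bexI[of _ "(i, V)"]) auto
  qed
  then obtain Q :: "('i, 'a) net" where Q: "tau_q_net X \<U> Q"
    "\<And>S k. k \<in> Field r \<times> \<U> \<Longrightarrow> (\<forall>l\<in>Field r \<times> \<U>. lt k l \<longrightarrow> y l \<in> S) \<Longrightarrow>
      \<forall>\<^sub>F x in tail_filter Q. x \<in> S"
    by blast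
  have "\<forall>\<^sub>F x in tail_filter Q. \<exists>i j. (i\<^sub>0, i) \<in> r \<and> (i, j) \<in> r \<and> L W x i \<and> R W x j"
    if i\<^sub>0: "i\<^sub>0 \<in> Field r" and W: "W \<in> \<U>" for i\<^sub>0 W
  proof -
    have k: "(i\<^sub>0, W) \<in> Field r \<times> \<U>" using i\<^sub>0 W by simp
    have "(i\<^sub>0, lo l) \<in> r \<and> (lo l, hi l) \<in> r \<and> L W (y l) (lo l) \<and> R W (y l) (hi l)"
      if l: "l \<in> Field r \<times> \<U>" and lt: "lt (i\<^sub>0, W) l" for l
    proof -
      have "(i\<^sub>0, fst l) \<in> r" using tr fst_hi[OF k] lt by (auto simp: lt_def)
      moreover have "snd l \<subseteq> W" using lt by (simp add: lt_def)
      ultimately show ?thesis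
        using tr lo[OF l] hi[OF l] L_mono R_mono yL[OF l] yR[OF l] by blast
    qed
    then have "\<forall>\<^sub>F x in tail_filter Q. x \<in> {x. \<exists>i j. (i\<^sub>0, i) \<in> r \<and> (i, j) \<in> r \<and> L W x i \<and> R W x j}"
      by (intro Q(2)[OF k]) blast
    then show ?thesis by simp
  qed
  with Q(1) show ?thesis by blast
qed

section \<open>Cuts and points\<close>

lemma tau_cutsD:
  assumes "\<xi> \<in> tau_cuts X \<U>"
  shows "fst \<xi> \<noteq> {}" "snd \<xi> \<noteq> {}"
    and "N \<in> fst \<xi> \<Longrightarrow> tau_p_net X \<U> N"
    and "M \<in> snd \<xi> \<Longrightarrow> tau_q_net X \<U> M"
    and "M \<in> snd \<xi> \<Longrightarrow> N \<in> fst \<xi> \<Longrightarrow> conet \<U> M N"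
    and "tau_q_net X \<U> M \<Longrightarrow> (\<And>N. N \<in> fst \<xi> \<Longrightarrow> conet \<U> M N) \<Longrightarrow> M \<in> snd \<xi>"
    and "tau_p_net X \<U> N \<Longrightarrow> (\<And>M. M \<in> snd \<xi> \<Longrightarrow> conet \<U> M N) \<Longrightarrow> N \<in> fst \<xi>"
  using assms[unfolded tau_cuts_def tau_cut_def mem_Collect_eq case_prod_beta]
  by (elim conjE, (assumption | meson))+

text \<open>
  The conet relation between \<open>\<tau>\<^sub>q\<close>-nets and \<open>\<tau>\<^sub>p\<close>-nets induces a Galois connection, and a cut is a
  pair of nonempty closed sets. The net \<open>Q\<^sub>0\<close> only makes the upper class nonempty.
\<close>

lemma tau_cut_generated:
  fixes T :: "('i, 'a) net set" and Q\<^sub>0 :: "('i, 'a) net"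
  assumes T: "\<And>N. N \<in> T \<Longrightarrow> tau_p_net X \<U> N" "T \<noteq> {}"
    and Q\<^sub>0: "tau_q_net X \<U> Q\<^sub>0" "\<And>N. N \<in> T \<Longrightarrow> conet \<U> Q\<^sub>0 N"
  shows "\<exists>\<xi>\<in>tau_cuts X \<U>. T \<subseteq> fst \<xi> \<and>
    snd \<xi> = {M. tau_q_net X \<U> M \<and> (\<forall>N\<in>T. conet \<U> M N)}"
proof -
  define B :: "('i, 'a) net set" where "B = {M. tau_q_net X \<U> M \<and> (\<forall>N\<in>T. conet \<U> M N)}"
  define A :: "('i, 'a) net set" where "A = {N. tau_p_net X \<U> N \<and> (\<forall>M\<in>B. conet \<U> M N)}"
  have TA: "T \<subseteq> A" using T(1) by (auto simp: A_def B_def)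
  have "Q\<^sub>0 \<in> B" using Q\<^sub>0 by (simp add: B_def)
  then have "B \<noteq> {}" by (metis empty_iff)
  have "A \<noteq> {}" using T(2) TA by (metis subset_empty)
  have "M \<in> B" if "tau_q_net X \<U> M" "\<forall>N\<in>A. conet \<U> M N" for M
    unfolding B_def using that(1) bspec[OF that(2) subsetD[OF TA]] by (intro CollectI conjI ballI)
  with \<open>A \<noteq> {}\<close> \<open>B \<noteq> {}\<close> have "tau_cut X \<U> (A, B)"
    unfolding tau_cut_def prod.case
  proof (intro conjI ballI allI impI)
    show "tau_p_net X \<U> N" if "N \<in> A" for N using that by (simp add: A_def)
    show "tau_q_net X \<U> M" if "M \<in> B" for M using that by (simp add: B_def)
    show "conet \<U> M N" if "M \<in> B" "N \<in> A" for M N using that by (simp add: A_def)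
    show "N \<in> A" if "tau_p_net X \<U> N \<and> (\<forall>M\<in>B. conet \<U> M N)" for N using that by (simp add: A_def)
  qed simp_all
  then show ?thesis using TA by (intro bexI[of _ "(A, B)"]) (auto simp: tau_cuts_def B_def)
qed

text \<open>
  For a point \<open>x\<close> the two definitions are asymmetric: a point above the cut has to be above all of its
  lower nets, whereas a point is below the cut when one lower net climbs over it.
\<close>

definition above_cut :: "('a \<times> 'a) set \<Rightarrow> 'a \<Rightarrow> ('i, 'a) cut \<Rightarrow> bool" where
  "above_cut W x \<xi> \<longleftrightarrow> (\<forall>N\<in>fst \<xi>. \<forall>\<^sub>F y in tail_filter N. (x, y) \<in> W)"

definition below_cut :: "('a \<times> 'a) set \<Rightarrow> 'a \<Rightarrow> ('i, 'a) cut \<Rightarrow> bool" where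
  "below_cut W x \<xi> \<longleftrightarrow> (\<exists>P\<in>fst \<xi>. \<forall>\<^sub>F y in tail_filter P. (y, x) \<in> W)"

definition dominates :: "('a \<times> 'a) set \<Rightarrow> ('i, 'a) cut \<Rightarrow> ('i, 'a) cut \<Rightarrow> bool" where
  "dominates W \<xi>' \<xi>'' \<longleftrightarrow> (\<exists>M\<in>fst \<xi>'. \<forall>N\<in>fst \<xi>''. tau_in M N W)"

lemma cut_entourage_iff:
  "(\<xi>', \<xi>'') \<in> cut_entourage X \<U> W \<longleftrightarrow> \<xi>' \<in> tau_cuts X \<U> \<and> \<xi>'' \<in> tau_cuts X \<U> \<and>
    (fst \<xi>'' \<subseteq> fst \<xi>' \<or> dominates W \<xi>' \<xi>'')"
  by (simp add: cut_entourage_def dominates_def)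

lemma above_cutD: "above_cut W x \<xi> \<Longrightarrow> N \<in> fst \<xi> \<Longrightarrow> \<forall>\<^sub>F y in tail_filter N. (x, y) \<in> W"
  by (simp add: above_cut_def)

lemma below_cutI: "P \<in> fst \<xi> \<Longrightarrow> \<forall>\<^sub>F y in tail_filter P. (y, x) \<in> W \<Longrightarrow> below_cut W x \<xi>"
  unfolding below_cut_def by (rule bexI)

lemma below_cutE:
  assumes "below_cut W x \<xi>"
  obtains P where "P \<in> fst \<xi>" "\<forall>\<^sub>F y in tail_filter P. (y, x) \<in> W"
  using assms unfolding below_cut_def by (rule bexE)

lemma dominatesI:
  "M \<in> fst \<xi>' \<Longrightarrow> (\<And>N. N \<in> fst \<xi>'' \<Longrightarrow> tau_in M N W) \<Longrightarrow> dominates W \<xi>' \<xi>''"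
  unfolding dominates_def by (rule bexI) (rule ballI)

lemma dominatesE:
  assumes "dominates W \<xi>' \<xi>''"
  obtains M where "M \<in> fst \<xi>'" "\<And>N. N \<in> fst \<xi>'' \<Longrightarrow> tau_in M N W"
  using assms unfolding dominates_def by (elim bexE) (metis (no_types))

lemma cut_entourageE:
  assumes "(\<xi>, \<xi>') \<in> cut_entourage X \<U> W" "N \<in> fst \<xi>'"
  obtains "N \<in> fst \<xi>" | P where "P \<in> fst \<xi>" "tau_in P N W"
proof -
  have "fst \<xi>' \<subseteq> fst \<xi> \<or> dominates W \<xi> \<xi>'" using assms(1) by (simp add: cut_entourage_iff)
  then show thesis
  proof
    assume "fst \<xi>' \<subseteq> fst \<xi>"
    then show thesis using assms(2) by (intro that(1)) (rule subsetD)
  next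
    assume "dominates W \<xi> \<xi>'"
    then obtain P where "P \<in> fst \<xi>" "tau_in P N W" by (rule dominatesE) (use assms(2) in blast)
    then show thesis by (rule that(2))
  qed
qed

lemma above_cut_mono: "V \<subseteq> W \<Longrightarrow> above_cut V x \<xi> \<Longrightarrow> above_cut W x \<xi>"
  unfolding above_cut_def by (intro ballI, drule bspec, assumption, erule eventually_mono) (rule subsetD)

lemma below_cut_mono: "V \<subseteq> W \<Longrightarrow> below_cut V x \<xi> \<Longrightarrow> below_cut W x \<xi>"
  by (elim below_cutE, rule below_cutI, assumption, erule eventually_mono) (rule subsetD)

lemma tau_in_mono: "V \<subseteq> W \<Longrightarrow> tau_in M N V \<Longrightarrow> tau_in M N W"
  by (cases M; cases N) (simp add: tau_in_def, blast)

lemma dominates_mono: "V \<subseteq> W \<Longrightarrow> dominates V \<xi>' \<xi>'' \<Longrightarrow> dominates W \<xi>' \<xi>''"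
  by (elim dominatesE, rule dominatesI, assumption) (rule tau_in_mono)

lemma entourage_cube:
  assumes "quasi_uniformity X \<U>" "U \<in> \<U>"
  obtains V where "V \<in> \<U>" "V O V O V \<subseteq> U" "V O V \<subseteq> U" "V \<subseteq> U"
proof -
  obtain W where W: "W \<in> \<U>" "W O W \<subseteq> U" using quasi_uniformityD(7)[OF assms] by blast
  obtain V where V: "V \<in> \<U>" "V O V \<subseteq> W" using quasi_uniformityD(7)[OF assms(1) W(1)] by blast
  have sub: "A \<subseteq> B" if "A \<in> \<U>" "A O A \<subseteq> B" for A B
    using that quasi_uniformityD(3,6)[OF assms(1) that(1)] by blast
  have "V \<subseteq> W" using sub V by blast
  moreover have "W \<subseteq> U" using sub W by blast
  ultimately show ?thesis using that[of V] V W by blast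
qed

lemma tau_in_eventually_eventually:
  assumes "net_in X M" "net_in Y N" "tau_in M N U"
  shows "\<forall>\<^sub>F x in tail_filter M. \<forall>\<^sub>F y in tail_filter N. (x, y) \<in> U"
  using assms by (auto simp: tau_in_iff_eventually dest: eventually_eventually_prod_filter1)

text \<open>
  The lower net of the cut that climbs over \<open>y\<close> lies below \<open>x\<close>; one of its members is the link.
\<close>

lemma above_cut_below_cut_relcomp:
  assumes "\<xi> \<in> tau_cuts X \<U>" "above_cut V x \<xi>" "below_cut W y \<xi>"
  shows "(x, y) \<in> V O W"
proof -
  obtain P where P: "P \<in> fst \<xi>" "\<forall>\<^sub>F z in tail_filter P. (z, y) \<in> W"
    using assms(3) by (rule below_cutE)
  have "\<forall>\<^sub>F z in tail_filter P. (x, z) \<in> V \<and> (z, y) \<in> W"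
    using above_cutD[OF assms(2) P(1)] P(2) by (rule eventually_conj)
  moreover have "tail_filter P \<noteq> bot"
    using tail_filter_neq_bot[OF tau_p_net_net_in[OF tau_cutsD(3)[OF assms(1) P(1)]]] .
  ultimately obtain z where "(x, z) \<in> V" "(z, y) \<in> W"
    using eventually_happens' by blast
  then show ?thesis by blast
qed

text \<open>
  A point between two cuts separates the choice of tails for the two nets, which is why joint tails
  can be found here.
\<close>

lemma dominates_through_point:
  assumes "\<xi>' \<in> tau_cuts X \<U>" "\<xi>'' \<in> tau_cuts X \<U>" "below_cut V x \<xi>'" "above_cut W x \<xi>''"
  shows "dominates (V O W) \<xi>' \<xi>''"
proof -
  obtain P where P: "P \<in> fst \<xi>'" "\<forall>\<^sub>F y in tail_filter P. (y, x) \<in> V"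
    using assms(3) by (rule below_cutE)
  have "tau_in P N (V O W)" if N: "N \<in> fst \<xi>''" for N
  proof -
    have "\<forall>\<^sub>F z in tail_filter N. (x, z) \<in> W" using assms(4) N by (rule above_cutD)
    from eventually_prodI[OF P(2) this]
    have "\<forall>\<^sub>F u in tail_filter P \<times>\<^sub>F tail_filter N. u \<in> V O W"
      by (rule eventually_mono) (auto simp: relcomp_unfold)
    moreover have "net_in X P" "net_in X N"
      using tau_p_net_net_in[OF tau_cutsD(3)] assms(1,2) P(1) N by blast+
    ultimately show ?thesis by (simp add: tau_in_iff_eventually)
  qed
  with P(1) show ?thesis by (rule dominatesI)
qed

context
  fixes X :: "'a set" and \<U> :: "('a \<times> 'a) set set"
  assumes qu: "quasi_uniformity X \<U>"
begin

lemma cut_net_in: "\<xi> \<in> tau_cuts X \<U> \<Longrightarrow> N \<in> fst \<xi> \<Longrightarrow> net_in X N"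
  by (rule tau_p_net_net_in[OF tau_cutsD(3)])

lemma conet_eventually:
  assumes "tau_q_net X \<U> M" "tau_p_net X \<U> N" "conet \<U> M N" "W \<in> \<U>"
  shows "\<forall>\<^sub>F x in tail_filter M. \<forall>\<^sub>F y in tail_filter N. (x, y) \<in> W"
proof -
  have "tau_in M N W" using assms(3,4) by (simp add: conet_def)
  then show ?thesis
    using tau_in_eventually_eventually[OF tau_q_net_net_in[OF assms(1)] tau_p_net_net_in[OF assms(2)]]
    by simp
qed

text \<open>
  The tail of \<open>Q\<close> that lies above a lower net depends on that net. The point \<open>x\<close> is above all members
  of \<open>Q\<close> that are late enough, so this dependence disappears for \<open>x\<close>.
\<close>

lemma above_cut_q_net:
  assumes \<xi>: "\<xi> \<in> tau_cuts X \<U>" and Q: "Q \<in> snd \<xi>"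
    and V: "V \<in> \<U>" and x: "\<forall>\<^sub>F y in tail_filter Q. (x, y) \<in> V"
  shows "above_cut (V O V) x \<xi>"
  unfolding above_cut_def
proof
  fix N assume N: "N \<in> fst \<xi>"
  have q: "tau_q_net X \<U> Q" by (rule tau_cutsD(4)[OF \<xi> Q])
  have "\<forall>\<^sub>F y in tail_filter Q. \<forall>\<^sub>F z in tail_filter N. (y, z) \<in> V"
    by (rule conet_eventually[OF q tau_cutsD(3)[OF \<xi> N] tau_cutsD(5)[OF \<xi> Q N] V])
  with x obtain y where y: "(x, y) \<in> V" "\<forall>\<^sub>F z in tail_filter N. (y, z) \<in> V"
    using eventually_happens'[OF tail_filter_neq_bot[OF tau_q_net_net_in[OF q]] eventually_conj] by blast
  show "\<forall>\<^sub>F z in tail_filter N. (x, z) \<in> V O V"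
    using y(2) by (rule eventually_mono) (use y(1) in blast)
qed

lemma above_cut_entourage:
  assumes W: "W \<in> \<U>" and xi: "(\<xi>, \<xi>') \<in> cut_entourage X \<U> W" and V: "above_cut V x \<xi>"
  shows "above_cut (V O W) x \<xi>'"
  unfolding above_cut_def
proof
  fix N assume N: "N \<in> fst \<xi>'"
  have cuts: "\<xi> \<in> tau_cuts X \<U>" "\<xi>' \<in> tau_cuts X \<U>" using xi by (auto simp: cut_entourage_iff)
  note Nnet = cut_net_in[OF cuts(2) N]
  consider "N \<in> fst \<xi>" | P where "P \<in> fst \<xi>" "tau_in P N W"
    using xi N by (rule cut_entourageE)
  then show "\<forall>\<^sub>F y in tail_filter N. (x, y) \<in> V O W"
  proof cases
    case 1
    have ev: "\<forall>\<^sub>F y in tail_filter N. (x, y) \<in> V" using V 1 by (rule above_cutD)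
    have "\<forall>\<^sub>F y in tail_filter N. y \<in> X"
      by (rule eventually_tail_filter_in[OF Nnet])
    with ev show ?thesis
      by eventually_elim (use quasi_uniformityD(6)[OF qu W] in blast)
  next
    case 2
    have "\<forall>\<^sub>F z in tail_filter P. (x, z) \<in> V" using V 2(1) by (rule above_cutD)
    moreover have "\<forall>\<^sub>F z in tail_filter P. \<forall>\<^sub>F y in tail_filter N. (z, y) \<in> W"
      using tau_in_eventually_eventually[OF cut_net_in[OF cuts(1) 2(1)] Nnet 2(2)] .
    ultimately have "\<forall>\<^sub>F z in tail_filter P. (x, z) \<in> V \<and> (\<forall>\<^sub>F y in tail_filter N. (z, y) \<in> W)"
      by (rule eventually_conj)
    then obtain z where z: "(x, z) \<in> V" "\<forall>\<^sub>F y in tail_filter N. (z, y) \<in> W"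
      using eventually_happens' tail_filter_neq_bot[OF cut_net_in[OF cuts(1) 2(1)]] by blast
    show ?thesis using z(2) by (rule eventually_mono) (use z(1) in blast)
  qed
qed

lemma below_cut_entourage:
  assumes V: "V \<in> \<U>" and xi: "(\<xi>', \<xi>) \<in> cut_entourage X \<U> V" and W: "below_cut W x \<xi>"
  shows "below_cut (V O W) x \<xi>'"
proof -
  have cuts: "\<xi> \<in> tau_cuts X \<U>" "\<xi>' \<in> tau_cuts X \<U>" using xi by (auto simp: cut_entourage_iff)
  obtain P where P: "P \<in> fst \<xi>" "\<forall>\<^sub>F y in tail_filter P. (y, x) \<in> W"
    using W by (rule below_cutE)
  consider "P \<in> fst \<xi>'" | M where "M \<in> fst \<xi>'" "tau_in M P V"
    using xi P(1) by (rule cut_entourageE)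
  then show ?thesis
  proof cases
    case 1
    have "\<forall>\<^sub>F y in tail_filter P. y \<in> X"
      by (rule eventually_tail_filter_in[OF cut_net_in[OF cuts(1) P(1)]])
    with P(2) have "\<forall>\<^sub>F y in tail_filter P. (y, x) \<in> V O W"
      by eventually_elim (use quasi_uniformityD(6)[OF qu V] in blast)
    with 1 show ?thesis by (rule below_cutI)
  next
    case 2
    have "\<forall>\<^sub>F y in tail_filter M. \<forall>\<^sub>F z in tail_filter P. (y, z) \<in> V"
      using tau_in_eventually_eventually[OF cut_net_in[OF cuts(2) 2(1)] cut_net_in[OF cuts(1) P(1)] 2(2)] .
    then have "\<forall>\<^sub>F y in tail_filter M. (y, x) \<in> V O W"
    proof eventually_elim
      case (elim y)
      then have "\<forall>\<^sub>F z in tail_filter P. (y, z) \<in> V \<and> (z, x) \<in> W" using P(2) by (rule eventually_conj)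
      then obtain z where "(y, z) \<in> V \<and> (z, x) \<in> W"
        using eventually_happens' tail_filter_neq_bot[OF cut_net_in[OF cuts(1) P(1)]] by blast
      then show ?case by blast
    qed
    with 2(1) show ?thesis by (rule below_cutI)
  qed
qed

lemma tau_in_comp:
  assumes "net_in X L" "net_in X M" "net_in X N" "tau_in L M V" "tau_in M N W"
  shows "tau_in L N (V O W)"
proof -
  obtain P Q where PQ: "eventually P (tail_filter L)" "eventually Q (tail_filter M)"
    "\<And>x y. P x \<Longrightarrow> Q y \<Longrightarrow> (x, y) \<in> V"
    using assms by (auto simp: tau_in_iff_eventually eventually_prod_filter)
  obtain R S where RS: "eventually R (tail_filter M)" "eventually S (tail_filter N)"
    "\<And>x y. R x \<Longrightarrow> S y \<Longrightarrow> (x, y) \<in> W"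
    using assms by (auto simp: tau_in_iff_eventually eventually_prod_filter)
  have "\<forall>\<^sub>F y in tail_filter M. Q y \<and> R y" using PQ(2) RS(1) by (rule eventually_conj)
  then obtain y where "Q y" "R y"
    using eventually_happens' tail_filter_neq_bot[OF assms(2)] by blast
  then have PS: "(x, z) \<in> V O W" if "P x" "S z" for x z using PQ(3) RS(3) that by blast
  from eventually_prodI[OF PQ(1) RS(2)]
  have "\<forall>\<^sub>F u in tail_filter L \<times>\<^sub>F tail_filter N. u \<in> V O W"
    by (rule eventually_mono) (metis PS prod.collapse)
  then show ?thesis using assms(1,3) by (simp add: tau_in_iff_eventually)
qed

lemma dominates_entourage:
  assumes V: "V \<in> \<U>" and W: "W \<subseteq> X \<times> X"
    and xi: "(\<xi>, \<xi>') \<in> cut_entourage X \<U> V" and \<xi>'': "\<xi>'' \<in> tau_cuts X \<U>"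
    and dom: "dominates W \<xi>' \<xi>''"
  shows "dominates (V O W) \<xi> \<xi>''"
proof -
  have cuts: "\<xi> \<in> tau_cuts X \<U>" "\<xi>' \<in> tau_cuts X \<U>" using xi by (auto simp: cut_entourage_iff)
  obtain M where M: "M \<in> fst \<xi>'" "\<And>N. N \<in> fst \<xi>'' \<Longrightarrow> tau_in M N W"
    using dom by (elim dominatesE) (rule that)
  consider "fst \<xi>' \<subseteq> fst \<xi>" | "dominates V \<xi> \<xi>'" using xi by (auto simp: cut_entourage_iff)
  then show ?thesis
  proof cases
    case 1
    then have "dominates W \<xi> \<xi>''" using dominatesI[OF _ M(2)] M(1) by blast
    moreover have "W \<subseteq> V O W" using W quasi_uniformityD(6)[OF qu V] by blast
    ultimately show ?thesis by (rule dominates_mono[rotated])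
  next
    case 2
    then obtain L where L: "L \<in> fst \<xi>" "tau_in L M V" using M(1) by (elim dominatesE) (rule that)
    show ?thesis
    proof (rule dominatesI[OF L(1)])
      fix N assume N: "N \<in> fst \<xi>''"
      show "tau_in L N (V O W)"
        using tau_in_comp[OF cut_net_in[OF cuts(1) L(1)] cut_net_in[OF cuts(2) M(1)]
            cut_net_in[OF \<xi>'' N] L(2) M(2)[OF N]] .
    qed
  qed
qed

text \<open>
  Each domination yields a net that is above every lower net of the next cut, but the tails needed
  depend on the latter net, and a lower net only increases: an early member may be too low. With an
  intermediate net \<open>M\<close> the first net \<open>L\<close> has to be compared with \<open>M\<close> only, and a single member \<open>x\<close> of
  \<open>L\<close> does this; the dependence on the lower nets of \<open>\<xi>\<^sub>4\<close> is absorbed by the tails of \<open>M\<close>.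
\<close>

lemma interpolating_point:
  assumes V: "V \<in> \<U>"
    and cuts: "\<xi>\<^sub>1 \<in> tau_cuts X \<U>" "\<xi>\<^sub>4 \<in> tau_cuts X \<U>"
    and dom: "dominates V \<xi>\<^sub>1 \<xi>\<^sub>2" "(\<xi>\<^sub>2, \<xi>\<^sub>3) \<in> cut_entourage X \<U> V" "dominates V \<xi>\<^sub>3 \<xi>\<^sub>4"
  shows "\<exists>x\<in>X. below_cut V x \<xi>\<^sub>1 \<and> above_cut (V O V O V) x \<xi>\<^sub>4"
proof -
  have \<xi>\<^sub>2: "\<xi>\<^sub>2 \<in> tau_cuts X \<U>" using dom(2) by (simp add: cut_entourage_iff)
  have "dominates (V O V) \<xi>\<^sub>2 \<xi>\<^sub>4"
    by (rule dominates_entourage[OF V quasi_uniformityD(3)[OF qu V] dom(2) cuts(2) dom(3)])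
  then obtain M where M: "M \<in> fst \<xi>\<^sub>2" "\<And>N. N \<in> fst \<xi>\<^sub>4 \<Longrightarrow> tau_in M N (V O V)"
    by (elim dominatesE) (rule that)
  obtain L where L: "L \<in> fst \<xi>\<^sub>1" "tau_in L M V" using dom(1) M(1) by (elim dominatesE) (rule that)
  note Mnet = cut_net_in[OF \<xi>\<^sub>2 M(1)] and Lnet = cut_net_in[OF cuts(1) L(1)]
  have "\<forall>\<^sub>F x in tail_filter L. (x \<in> X \<and> (\<forall>\<^sub>F y in tail_filter L. (y, x) \<in> V)) \<and>
      (\<forall>\<^sub>F y in tail_filter M. (x, y) \<in> V)"
    using eventually_tail_p_net[OF tau_cutsD(3)[OF cuts(1) L(1)] V]
      tau_in_eventually_eventually[OF Lnet Mnet L(2)] by (rule eventually_conj)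
  then obtain x where x: "x \<in> X" "\<forall>\<^sub>F y in tail_filter L. (y, x) \<in> V"
      "\<forall>\<^sub>F y in tail_filter M. (x, y) \<in> V"
    using eventually_happens' tail_filter_neq_bot[OF Lnet] by blast
  have "\<forall>\<^sub>F z in tail_filter N. (x, z) \<in> V O V O V" if N: "N \<in> fst \<xi>\<^sub>4" for N
  proof -
    have "\<forall>\<^sub>F y in tail_filter M. (x, y) \<in> V \<and> (\<forall>\<^sub>F z in tail_filter N. (y, z) \<in> V O V)"
      using x(3) tau_in_eventually_eventually[OF Mnet cut_net_in[OF cuts(2) N] M(2)[OF N]]
      by (rule eventually_conj)
    then obtain y where y: "(x, y) \<in> V" "\<forall>\<^sub>F z in tail_filter N. (y, z) \<in> V O V"
      using eventually_happens' tail_filter_neq_bot[OF Mnet] by blast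
    show ?thesis using y(2) by (rule eventually_mono) (use y(1) in blast)
  qed
  then have "above_cut (V O V O V) x \<xi>\<^sub>4" unfolding above_cut_def by (rule ballI)
  then show ?thesis using x(1) below_cutI[OF L(1) x(2)] by blast
qed

section \<open>The quasi-uniformity of the complement\<close>

text \<open>
  If \<open>V O V O V \<subseteq> U\<close>, then \<open>V\<close> is contained in the interior of \<open>U\<close>, because the points \<open>V\<close>-above
  \<open>x\<close> and those \<open>V\<close>-below \<open>y\<close> form a rectangular neighbourhood of \<open>(x, y) \<in> V\<close> inside \<open>U\<close>. Thus all
  entourages of \<open>X\<close>, not only the open ones, may be used to describe the complement.
\<close>

lemma ex_open_entourage:
  assumes U: "U \<in> \<U>"
  shows "\<exists>W\<in>open_entourages X \<U>. W \<subseteq> U"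
proof -
  let ?T = "prod_topology (qu_topology X (conjugate \<U>)) (qu_topology X \<U>)"
  obtain V where V: "V \<in> \<U>" "V O V O V \<subseteq> U" using entourage_cube[OF qu U] by metis
  have VX: "V \<subseteq> X \<times> X" by (rule quasi_uniformityD(3)[OF qu V(1)])
  have "V \<subseteq> ?T interior_of U"
  proof
    fix z assume "z \<in> V"
    then obtain x y where z: "z = (x, y)" "(x, y) \<in> V" "x \<in> X" "y \<in> X" using VX by (cases z) auto
    obtain S where S: "openin (qu_topology X (conjugate \<U>)) S" "x \<in> S" "S \<subseteq> V\<inverse> `` {x}"
      using qu_topology_nbhd[OF quasi_uniformity_conjugate[OF qu] z(3), of "V\<inverse> `` {x}"] V(1)
      by (auto simp: conjugate_def)
    obtain T where T: "openin (qu_topology X \<U>) T" "y \<in> T" "T \<subseteq> V `` {y}"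
      using qu_topology_nbhd[OF qu z(4), of "V `` {y}"] V(1) by blast
    have "S \<times> T \<subseteq> U" using S(3) T(3) z(2) V(2) by blast
    moreover have "openin ?T (S \<times> T)" using S(1) T(1) by (simp add: openin_prod_Times_iff)
    ultimately have "S \<times> T \<subseteq> ?T interior_of U" by (rule interior_of_maximal)
    then show "z \<in> ?T interior_of U" using S(2) T(2) z(1) by blast
  qed
  moreover have sub: "?T interior_of U \<subseteq> U" by (rule interior_of_subset)
  ultimately have "?T interior_of U \<in> \<U>"
    using quasi_uniformityD(4)[OF qu V(1)] quasi_uniformityD(3)[OF qu U] by blast
  then show ?thesis using sub by (auto simp: open_entourages_def)
qed

lemma cut_entourage_mono: "V \<subseteq> W \<Longrightarrow> cut_entourage X \<U> V \<subseteq> cut_entourage X \<U> W"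
proof (rule subrelI)
  fix \<xi> \<xi>'
  assume VW: "V \<subseteq> W" and "(\<xi>, \<xi>') \<in> cut_entourage X \<U> V"
  then show "(\<xi>, \<xi>') \<in> cut_entourage X \<U> W"
    using dominates_mono[OF VW, of \<xi> \<xi>'] unfolding cut_entourage_iff by blast
qed

lemma cut_entourage_in_cut_uniformity:
  assumes "W \<in> \<U>"
  shows "cut_entourage X \<U> W \<in> cut_uniformity X \<U>"
proof -
  obtain V where "V \<in> open_entourages X \<U>" "V \<subseteq> W" using ex_open_entourage[OF assms] by blast
  then have "\<exists>V\<in>open_entourages X \<U>. cut_entourage X \<U> V \<subseteq> cut_entourage X \<U> W"
    using cut_entourage_mono by (intro bexI)
  moreover have "cut_entourage X \<U> W \<subseteq> tau_cuts X \<U> \<times> tau_cuts X \<U>"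
    by (auto simp: cut_entourage_iff)
  ultimately show ?thesis by (simp add: cut_uniformity_def)
qed

lemma cut_uniformity_iff:
  "S \<in> cut_uniformity X \<U> \<longleftrightarrow>
    S \<subseteq> tau_cuts X \<U> \<times> tau_cuts X \<U> \<and> (\<exists>W\<in>\<U>. cut_entourage X \<U> W \<subseteq> S)"
proof
  show "S \<subseteq> tau_cuts X \<U> \<times> tau_cuts X \<U> \<and> (\<exists>W\<in>\<U>. cut_entourage X \<U> W \<subseteq> S)"
    if S: "S \<in> cut_uniformity X \<U>"
  proof -
    obtain W where "W \<in> open_entourages X \<U>" "cut_entourage X \<U> W \<subseteq> S"
      using S unfolding cut_uniformity_def by blast
    moreover from this(1) have "W \<in> \<U>" by (simp add: open_entourages_def)
    ultimately show ?thesis using S unfolding cut_uniformity_def by blast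
  qed
next
  assume S: "S \<subseteq> tau_cuts X \<U> \<times> tau_cuts X \<U> \<and> (\<exists>W\<in>\<U>. cut_entourage X \<U> W \<subseteq> S)"
  then obtain W where W: "W \<in> \<U>" "cut_entourage X \<U> W \<subseteq> S" by blast
  obtain V where V: "V \<in> open_entourages X \<U>" "V \<subseteq> W" using ex_open_entourage[OF W(1)] by blast
  have "cut_entourage X \<U> V \<subseteq> S" using cut_entourage_mono[OF V(2)] W(2) by (rule order_trans)
  then show "S \<in> cut_uniformity X \<U>" using S V(1) unfolding cut_uniformity_def by blast
qed

text \<open>
  Inclusion composes with either alternative, since it enlarges the supply of dominating nets on the
  left and removes nets to be dominated on the right; two dominations compose through a
  common tail of the intermediate net.
\<close>

lemma cut_entourage_comp:
  assumes V: "V \<in> \<U>" "V O V \<subseteq> W"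
  shows "cut_entourage X \<U> V O cut_entourage X \<U> V \<subseteq> cut_entourage X \<U> W"
proof clarify
  fix \<xi>\<^sub>1 \<xi>\<^sub>2 \<xi>\<^sub>3 :: "('i, 'a) cut"
  assume 12: "(\<xi>\<^sub>1, \<xi>\<^sub>2) \<in> cut_entourage X \<U> V" and 23: "(\<xi>\<^sub>2, \<xi>\<^sub>3) \<in> cut_entourage X \<U> V"
  have cuts: "\<xi>\<^sub>1 \<in> tau_cuts X \<U>" "\<xi>\<^sub>3 \<in> tau_cuts X \<U>" using 12 23 by (auto simp: cut_entourage_iff)
  consider "dominates V \<xi>\<^sub>2 \<xi>\<^sub>3" | "fst \<xi>\<^sub>3 \<subseteq> fst \<xi>\<^sub>2" "fst \<xi>\<^sub>2 \<subseteq> fst \<xi>\<^sub>1"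
    | "fst \<xi>\<^sub>3 \<subseteq> fst \<xi>\<^sub>2" "dominates V \<xi>\<^sub>1 \<xi>\<^sub>2"
    using 12 23 by (auto simp: cut_entourage_iff)
  then have "fst \<xi>\<^sub>3 \<subseteq> fst \<xi>\<^sub>1 \<or> dominates W \<xi>\<^sub>1 \<xi>\<^sub>3"
  proof cases
    case 1
    then have "dominates (V O V) \<xi>\<^sub>1 \<xi>\<^sub>3"
      using dominates_entourage[OF V(1) quasi_uniformityD(3)[OF qu V(1)] 12 cuts(2)] by blast
    then show ?thesis using dominates_mono[OF V(2)] by blast
  next
    case 2
    then show ?thesis by blast
  next
    case 3
    from 3(2) have "dominates V \<xi>\<^sub>1 \<xi>\<^sub>3"
      by (rule dominatesE) (rule dominatesI, assumption, meson 3(1) subsetD)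
    moreover have "V \<subseteq> W" using V(2) quasi_uniformityD(3,6)[OF qu V(1)] by blast
    ultimately show ?thesis using dominates_mono by blast
  qed
  then show "(\<xi>\<^sub>1, \<xi>\<^sub>3) \<in> cut_entourage X \<U> W" using cuts by (simp add: cut_entourage_iff)
qed

lemma tau_cuts_nonempty: "(tau_cuts X \<U> :: ('i, 'a) cut set) \<noteq> {}"
proof -
  obtain x where x: "x \<in> X" using quasi_uniformityD(1)[OF qu] by blast
  obtain i :: 'i where True by blast
  \<comment> \<open>The constant net at \<open>x\<close> is a \<open>\<tau>\<^sub>p\<close>-net and a \<open>\<tau>\<^sub>q\<close>-net and its own conet.\<close>
  define N :: "('i, 'a) net" where "N = ({(i, i)}, \<lambda>j\<in>{i}. x)"
  have diag: "(x, x) \<in> W" if "W \<in> \<U>" for W using quasi_uniformityD(6)[OF qu that] x by blast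
  have "net_in X N"
    using x by (auto simp: N_def net_in_def directed_preorder_def preorder_on_def refl_on_def
        Field_def trans_def)
  then have p: "tau_p_net X \<U> N" and q: "tau_q_net X \<U> N"
    using diag by (auto simp: N_def tau_p_net_def tau_q_net_def Field_def)
  have "conet \<U> N N" using diag by (auto simp: N_def conet_def tau_in_def Field_def)
  then have "\<exists>\<xi> :: ('i, 'a) cut \<in> tau_cuts X \<U>. {N} \<subseteq> fst \<xi> \<and>
      snd \<xi> = {M. tau_q_net X \<U> M \<and> (\<forall>N\<in>{N}. conet \<U> M N)}"
    by (intro tau_cut_generated[of _ _ _ N]) (use p q in auto)
  then show ?thesis by blast
qed

lemma quasi_uniformity_cut_uniformity:
  "quasi_uniformity (tau_cuts X \<U> :: ('i, 'a) cut set) (cut_uniformity X \<U>)"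
  unfolding quasi_uniformity_def
proof (intro conjI ballI allI impI)
  let ?Y = "tau_cuts X \<U> :: ('i, 'a) cut set" and ?\<V> = "cut_uniformity X \<U> :: (('i, 'a) cut \<times> _) set set"
  show "?Y \<noteq> {}" by (rule tau_cuts_nonempty)
  show "?\<V> \<noteq> {}" using cut_entourage_in_cut_uniformity quasi_uniformityD(2)[OF qu] by blast
  fix S assume S: "S \<in> ?\<V>"
  then obtain W where W: "W \<in> \<U>" "cut_entourage X \<U> W \<subseteq> S" by (auto simp: cut_uniformity_iff)
  show "S \<subseteq> ?Y \<times> ?Y" using S by (simp add: cut_uniformity_iff)
  show "T \<in> ?\<V>" if "S \<subseteq> T \<and> T \<subseteq> ?Y \<times> ?Y" for T
    using that W unfolding cut_uniformity_iff by blast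
  show "S \<inter> T \<in> ?\<V>" if "T \<in> ?\<V>" for T
  proof -
    obtain V where V: "V \<in> \<U>" "cut_entourage X \<U> V \<subseteq> T"
      using \<open>T \<in> ?\<V>\<close> by (auto simp: cut_uniformity_iff)
    have "W \<inter> V \<in> \<U>" using quasi_uniformityD(5)[OF qu W(1) V(1)] .
    moreover have "cut_entourage X \<U> (W \<inter> V) \<subseteq> S \<inter> T"
      using cut_entourage_mono[of "W \<inter> V" W] cut_entourage_mono[of "W \<inter> V" V] W V by blast
    ultimately show ?thesis using S unfolding cut_uniformity_iff by blast
  qed
  show "Id_on ?Y \<subseteq> S" using W(2) by (auto simp: cut_entourage_iff)
  obtain V where V: "V \<in> \<U>" "V O V \<subseteq> W" using quasi_uniformityD(7)[OF qu W(1)] by blast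
  show "\<exists>T\<in>?\<V>. T O T \<subseteq> S"
    using cut_entourage_in_cut_uniformity[OF V(1)] cut_entourage_comp[OF V] W(2)
    by (meson order_trans)
qed

end

section \<open>Limits of Cauchy nets of cuts\<close>

text \<open>
  These conditions are one half of convergence: \<open>P\<close> does not exceed the limit of \<open>N\<close>, and \<open>Q\<close> is not
  below the limit of \<open>M\<close>. They are what the formation of the limit cut needs, and they hold for the
  nets in the lower classes of late cuts when the cuts eventually increase (dually, for those in the
  upper classes when the cuts eventually decrease).
\<close>

definition p_limit :: "'a set \<Rightarrow> ('a \<times> 'a) set set \<Rightarrow> ('j, ('i, 'a) cut) net \<Rightarrow> ('i, 'a) net \<Rightarrow> bool" where
  "p_limit X \<U> N P \<longleftrightarrow> tau_p_net X \<U> P \<and>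
    (\<forall>W\<in>\<U>. \<forall>\<^sub>F x in tail_filter P. \<forall>\<^sub>F \<zeta> in tail_filter N. below_cut W x \<zeta>)"

definition q_limit :: "'a set \<Rightarrow> ('a \<times> 'a) set set \<Rightarrow> ('j, ('i, 'a) cut) net \<Rightarrow> ('i, 'a) net \<Rightarrow> bool" where
  "q_limit X \<U> M Q \<longleftrightarrow> tau_q_net X \<U> Q \<and>
    (\<forall>W\<in>\<U>. \<forall>\<^sub>F x in tail_filter Q. \<forall>\<^sub>F \<zeta> in tail_filter M. above_cut W x \<zeta>)"

context
  fixes X :: "'a set" and \<U> :: "('a \<times> 'a) set set"
  assumes qu: "quasi_uniformity X \<U>"
begin

text \<open>
  The other half of convergence, for an increasing Cauchy net of cuts: its late members are below some
  limit up to \<open>U\<close>. Either the lower classes eventually increase and their own nets are limits, or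
  dominations occur arbitrarily late and the diagonal net of interpolated points serves for all
  late members.
\<close>

lemma p_limits_of_cut_net:
  fixes N :: "('j, ('i, 'a) cut) net"
  assumes large: "large_index_type TYPE('i) TYPE('a)"
    and N: "tau_p_net (tau_cuts X \<U>) (cut_uniformity X \<U>) N"
    and U: "U \<in> \<U>"
  shows "\<forall>\<^sub>F \<zeta> in tail_filter N. (\<forall>P\<in>fst \<zeta>. p_limit X \<U> N P) \<or>
    (\<exists>P. p_limit X \<U> N P \<and> (\<forall>\<^sub>F x in tail_filter P. above_cut U x \<zeta>))"
proof -
  obtain r \<xi> where N_eq: "N = (r, \<xi>)" by (cases N)
  have net: "net_in (tau_cuts X \<U>) (r, \<xi>)" using tau_p_net_net_in[OF N] N_eq by simp
  note dir = net_in_directed[OF net]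
  note tr = directed_preorder_trans[OF dir]
  note ev = eventually_tail_filter[OF net, folded N_eq]
  have cut: "\<xi> a \<in> tau_cuts X \<U>" if "a \<in> Field r" for a using net_in_value[OF net that] .
  have cauchy: "\<exists>c\<in>Field r. \<forall>a a'. (c, a) \<in> r \<longrightarrow> (a, a') \<in> r \<longrightarrow> (\<xi> a', \<xi> a) \<in> cut_entourage X \<U> W"
    if "W \<in> \<U>" for W
  proof -
    have "\<forall>W\<in>cut_uniformity X \<U>. \<exists>c\<in>Field r. \<forall>a a'. (c, a) \<in> r \<and> (a, a') \<in> r \<longrightarrow> (\<xi> a', \<xi> a) \<in> W"
      using N by (simp add: N_eq tau_p_net_def)
    from bspec[OF this cut_entourage_in_cut_uniformity[OF qu that]] show ?thesis by blast
  qed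
  show ?thesis
  proof (cases "\<exists>c\<in>Field r. \<forall>a a'. (c, a) \<in> r \<longrightarrow> (a, a') \<in> r \<longrightarrow> fst (\<xi> a) \<subseteq> fst (\<xi> a')")
    case True
    then obtain c where c: "c \<in> Field r"
      "\<And>a a'. (c, a) \<in> r \<Longrightarrow> (a, a') \<in> r \<Longrightarrow> fst (\<xi> a) \<subseteq> fst (\<xi> a')" by blast
    have "p_limit X \<U> N P" if a: "(c, a) \<in> r" and P: "P \<in> fst (\<xi> a)" for a P
      unfolding p_limit_def
    proof (intro conjI ballI)
      have ar: "a \<in> Field r" using a by (rule FieldI2)
      show p: "tau_p_net X \<U> P" using tau_cutsD(3)[OF cut[OF ar] P] .
      fix W assume W: "W \<in> \<U>"
      show "\<forall>\<^sub>F x in tail_filter P. \<forall>\<^sub>F \<zeta> in tail_filter N. below_cut W x \<zeta>"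
        using eventually_tail_p_net[OF p W]
      proof (rule eventually_mono)
        fix x assume x: "x \<in> X \<and> (\<forall>\<^sub>F y in tail_filter P. (y, x) \<in> W)"
        have "below_cut W x (\<xi> a')" if "(a, a') \<in> r" for a'
          using below_cutI[of P "\<xi> a'"] c(2)[OF a that] P x by blast
        then show "\<forall>\<^sub>F \<zeta> in tail_filter N. below_cut W x \<zeta>" unfolding ev using ar by blast
      qed
    qed
    then show ?thesis unfolding ev using c(1) by blast
  next
    case False
    have dom: "\<exists>a a'. (c, a) \<in> r \<and> (a, a') \<in> r \<and> dominates W (\<xi> a') (\<xi> a)"
      if W: "W \<in> \<U>" and c: "c \<in> Field r" for W c
    proof (rule ccontr)
      assume contr: "\<not> ?thesis"
      obtain d where d: "d \<in> Field r"
        "\<And>a a'. (d, a) \<in> r \<Longrightarrow> (a, a') \<in> r \<Longrightarrow> (\<xi> a', \<xi> a) \<in> cut_entourage X \<U> W"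
        using cauchy[OF W] by blast
      obtain e where e: "e \<in> Field r" "(c, e) \<in> r" "(d, e) \<in> r"
        using directed_preorder_upper_bound[OF dir c d(1)] .
      have "fst (\<xi> a) \<subseteq> fst (\<xi> a')" if "(e, a) \<in> r" "(a, a') \<in> r" for a a'
        using d(2)[OF tr[OF e(3) that(1)] that(2)] contr tr[OF e(2) that(1)] that(2)
        by (auto simp: cut_entourage_iff)
      with e(1) False show False by blast
    qed
    have "\<exists>P :: ('i, 'a) net. tau_q_net X (conjugate \<U>) P \<and> (\<forall>c\<in>Field r. \<forall>W\<in>conjugate \<U>.
        \<forall>\<^sub>F x in tail_filter P. \<exists>i j. (c, i) \<in> r \<and> (i, j) \<in> r \<and>
          above_cut (W\<inverse>) x (\<xi> i) \<and> below_cut (W\<inverse>) x (\<xi> j))"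
    proof (rule diagonal_q_net[OF large quasi_uniformity_conjugate[OF qu] dir])
      show "above_cut (W\<inverse>) x (\<xi> i)" if "V \<subseteq> W" "above_cut (V\<inverse>) x (\<xi> i)" for V W x i
        using above_cut_mono[OF _ that(2)] that(1) by blast
      show "below_cut (W\<inverse>) x (\<xi> i)" if "V \<subseteq> W" "below_cut (V\<inverse>) x (\<xi> i)" for V W x i
        using below_cut_mono[OF _ that(2)] that(1) by blast
    next
      fix W' c assume W': "W' \<in> conjugate \<U>" and c: "c \<in> Field r"
      then obtain W where W: "W \<in> \<U>" "W' = W\<inverse>" by (auto simp: conjugate_def)
      obtain V where V: "V \<in> \<U>" "V O V O V \<subseteq> W" "V \<subseteq> W"
        using entourage_cube[OF qu W(1)] by metis
      obtain d where d: "d \<in> Field r"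
        "\<And>a a'. (d, a) \<in> r \<Longrightarrow> (a, a') \<in> r \<Longrightarrow> (\<xi> a', \<xi> a) \<in> cut_entourage X \<U> V"
        using cauchy[OF V(1)] by blast
      obtain e where e: "e \<in> Field r" "(c, e) \<in> r" "(d, e) \<in> r"
        using directed_preorder_upper_bound[OF dir c d(1)] .
      obtain a a' where a: "(e, a) \<in> r" "(a, a') \<in> r" "dominates V (\<xi> a') (\<xi> a)"
        using dom[OF V(1) e(1)] by blast
      obtain b b' where b: "(a', b) \<in> r" "(b, b') \<in> r" "dominates V (\<xi> b') (\<xi> b)"
        using dom[OF V(1) FieldI2[OF a(2)]] by blast
      have "(\<xi> b, \<xi> a') \<in> cut_entourage X \<U> V"
        using d(2)[OF tr[OF tr[OF e(3) a(1)] a(2)] b(1)] .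
      then obtain x where x: "x \<in> X" "below_cut V x (\<xi> b')" "above_cut (V O V O V) x (\<xi> a)"
        using interpolating_point[OF qu V(1) cut[OF FieldI2[OF b(2)]] cut[OF FieldI2[OF a(1)]] b(3) _ a(3)]
        by blast
      have "below_cut W x (\<xi> b')" "above_cut W x (\<xi> a)"
        using below_cut_mono[OF V(3) x(2)] above_cut_mono[OF V(2) x(3)] by auto
      then show "\<exists>i j. \<exists>x\<in>X. (c, i) \<in> r \<and> (i, j) \<in> r \<and>
          above_cut (W'\<inverse>) x (\<xi> i) \<and> below_cut (W'\<inverse>) x (\<xi> j)"
        using x(1) tr[OF e(2) a(1)] tr[OF a(2) tr[OF b(1) b(2)]] unfolding W(2) converse_converse
        by blast
    next
      fix W' assume "W' \<in> conjugate \<U>"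
      then obtain W where W: "W \<in> \<U>" "W' = W\<inverse>" by (auto simp: conjugate_def)
      obtain V where V: "V \<in> \<U>" "V O V O V \<subseteq> W" using entourage_cube[OF qu W(1)] by metis
      obtain d where d: "d \<in> Field r"
        "\<And>a a'. (d, a) \<in> r \<Longrightarrow> (a, a') \<in> r \<Longrightarrow> (\<xi> a', \<xi> a) \<in> cut_entourage X \<U> V"
        using cauchy[OF V(1)] by blast
      have "(y, x) \<in> W" if "(d, i) \<in> r" "(i, j) \<in> r" "below_cut V x (\<xi> i)" "above_cut V y (\<xi> j)"
        for i j x y
      proof -
        have "above_cut (V O V) y (\<xi> i)"
          using above_cut_entourage[OF qu V(1) d(2)[OF that(1,2)] that(4)] .
        then have "(y, x) \<in> (V O V) O V"
          using above_cut_below_cut_relcomp[OF cut[OF FieldI2[OF that(1)]] _ that(3)] by blast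
        then show ?thesis using V(2) by (auto simp: O_assoc)
      qed
      then show "\<exists>V\<in>conjugate \<U>. \<exists>c\<in>Field r. \<forall>i j x y. (c, i) \<in> r \<longrightarrow> (i, j) \<in> r \<longrightarrow>
          below_cut (V\<inverse>) x (\<xi> i) \<longrightarrow> above_cut (V\<inverse>) y (\<xi> j) \<longrightarrow> (x, y) \<in> W'"
        using V(1) d(1) unfolding W(2) conjugate_def by (intro bexI[of _ "V\<inverse>"] bexI[of _ d]) auto
    qed
    then obtain P :: "('i, 'a) net" where p: "tau_p_net X \<U> P"
      and P: "\<And>c W. c \<in> Field r \<Longrightarrow> W \<in> \<U> \<Longrightarrow> \<forall>\<^sub>F x in tail_filter P.
        \<exists>i j. (c, i) \<in> r \<and> (i, j) \<in> r \<and> above_cut W x (\<xi> i) \<and> below_cut W x (\<xi> j)"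
      unfolding tau_p_net_iff_conjugate conjugate_def ball_simps converse_converse by blast
    have lim: "p_limit X \<U> N P"
      unfolding p_limit_def
    proof (intro conjI ballI)
      show "tau_p_net X \<U> P" by (rule p)
      fix W assume W: "W \<in> \<U>"
      obtain V where V: "V \<in> \<U>" "V O V \<subseteq> W" using quasi_uniformityD(7)[OF qu W] by blast
      obtain d where d: "d \<in> Field r"
        "\<And>a a'. (d, a) \<in> r \<Longrightarrow> (a, a') \<in> r \<Longrightarrow> (\<xi> a', \<xi> a) \<in> cut_entourage X \<U> V"
        using cauchy[OF V(1)] by blast
      show "\<forall>\<^sub>F x in tail_filter P. \<forall>\<^sub>F \<zeta> in tail_filter N. below_cut W x \<zeta>"
        using P[OF d(1) V(1)]
      proof (rule eventually_mono)
        fix x assume "\<exists>i j. (d, i) \<in> r \<and> (i, j) \<in> r \<and> above_cut V x (\<xi> i) \<and> below_cut V x (\<xi> j)"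
        then obtain i j where j: "(d, i) \<in> r" "(i, j) \<in> r" "below_cut V x (\<xi> j)" by blast
        have "below_cut W x (\<xi> a)" if "(j, a) \<in> r" for a
          using below_cut_entourage[OF qu V(1) d(2)[OF tr[OF j(1,2)] that] j(3)]
          by (rule below_cut_mono[OF V(2)])
        then show "\<forall>\<^sub>F \<zeta> in tail_filter N. below_cut W x \<zeta>"
          unfolding ev using FieldI2[OF j(2)] by blast
      qed
    qed
    have "\<forall>\<^sub>F \<zeta> in tail_filter N. \<forall>\<^sub>F x in tail_filter P. above_cut U x \<zeta>"
    proof -
      obtain V where V: "V \<in> \<U>" "V O V \<subseteq> U" using quasi_uniformityD(7)[OF qu U] by blast
      obtain d where d: "d \<in> Field r"
        "\<And>a a'. (d, a) \<in> r \<Longrightarrow> (a, a') \<in> r \<Longrightarrow> (\<xi> a', \<xi> a) \<in> cut_entourage X \<U> V"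
        using cauchy[OF V(1)] by blast
      have "\<forall>\<^sub>F x in tail_filter P. above_cut U x (\<xi> a)" if a: "(d, a) \<in> r" for a
        using P[OF FieldI2[OF a] V(1)]
      proof (rule eventually_mono)
        fix x assume "\<exists>i j. (a, i) \<in> r \<and> (i, j) \<in> r \<and> above_cut V x (\<xi> i) \<and> below_cut V x (\<xi> j)"
        then obtain i where i: "(a, i) \<in> r" "above_cut V x (\<xi> i)" by blast
        show "above_cut U x (\<xi> a)"
          using above_cut_entourage[OF qu V(1) d(2)[OF a i(1)] i(2)]
          by (rule above_cut_mono[OF V(2)])
      qed
      then show ?thesis unfolding ev using d(1) by blast
    qed
    then show ?thesis by (rule eventually_mono) (use lim in blast)
  qed
qed

text \<open>
  The decreasing counterpart. It is not a formal dual of \<open>p_limits_of_cut_net\<close>, since the entourages of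
  cuts are defined through the lower classes only. When the lower classes eventually decrease, the
  upper classes increase, and \<open>above_cut_q_net\<close> replaces the direct argument.
\<close>

lemma q_limits_of_cut_net:
  fixes M :: "('j, ('i, 'a) cut) net"
  assumes large: "large_index_type TYPE('i) TYPE('a)"
    and M: "tau_q_net (tau_cuts X \<U>) (cut_uniformity X \<U>) M"
    and U: "U \<in> \<U>"
  shows "\<forall>\<^sub>F \<zeta> in tail_filter M. (\<forall>Q\<in>snd \<zeta>. q_limit X \<U> M Q) \<or>
    (\<exists>Q. q_limit X \<U> M Q \<and> (\<forall>\<^sub>F x in tail_filter Q. below_cut U x \<zeta>))"
proof -
  obtain r \<eta> where M_eq: "M = (r, \<eta>)" by (cases M)
  have net: "net_in (tau_cuts X \<U>) (r, \<eta>)" using tau_q_net_net_in[OF M] M_eq by simp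
  note dir = net_in_directed[OF net]
  note tr = directed_preorder_trans[OF dir]
  note ev = eventually_tail_filter[OF net, folded M_eq]
  have cut: "\<eta> a \<in> tau_cuts X \<U>" if "a \<in> Field r" for a using net_in_value[OF net that] .
  have cauchy: "\<exists>c\<in>Field r. \<forall>a a'. (c, a) \<in> r \<longrightarrow> (a, a') \<in> r \<longrightarrow> (\<eta> a, \<eta> a') \<in> cut_entourage X \<U> W"
    if "W \<in> \<U>" for W
  proof -
    have "\<forall>W\<in>cut_uniformity X \<U>. \<exists>c\<in>Field r. \<forall>a a'. (c, a) \<in> r \<and> (a, a') \<in> r \<longrightarrow> (\<eta> a, \<eta> a') \<in> W"
      using M by (simp add: M_eq tau_q_net_def)
    from bspec[OF this cut_entourage_in_cut_uniformity[OF qu that]] show ?thesis by blast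
  qed
  show ?thesis
  proof (cases "\<exists>c\<in>Field r. \<forall>a a'. (c, a) \<in> r \<longrightarrow> (a, a') \<in> r \<longrightarrow> fst (\<eta> a') \<subseteq> fst (\<eta> a)")
    case True
    then obtain c where c: "c \<in> Field r"
      "\<And>a a'. (c, a) \<in> r \<Longrightarrow> (a, a') \<in> r \<Longrightarrow> fst (\<eta> a') \<subseteq> fst (\<eta> a)" by blast
    have "q_limit X \<U> M Q" if a: "(c, a) \<in> r" and Q: "Q \<in> snd (\<eta> a)" for a Q
      unfolding q_limit_def
    proof (intro conjI ballI)
      have ar: "a \<in> Field r" using a by (rule FieldI2)
      show q: "tau_q_net X \<U> Q" using tau_cutsD(4)[OF cut[OF ar] Q] .
      fix W assume W: "W \<in> \<U>"
      obtain V where V: "V \<in> \<U>" "V O V \<subseteq> W" using quasi_uniformityD(7)[OF qu W] by blast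
      show "\<forall>\<^sub>F x in tail_filter Q. \<forall>\<^sub>F \<zeta> in tail_filter M. above_cut W x \<zeta>"
        using eventually_tail_q_net[OF q V(1)]
      proof (rule eventually_mono)
        fix x assume x: "x \<in> X \<and> (\<forall>\<^sub>F y in tail_filter Q. (x, y) \<in> V)"
        have "above_cut W x (\<eta> a')" if a': "(a, a') \<in> r" for a'
        proof -
          have "above_cut W x (\<eta> a)"
            using above_cut_mono[OF V(2) above_cut_q_net[OF qu cut[OF ar] Q V(1)]] x by blast
          then show ?thesis using c(2)[OF a a'] unfolding above_cut_def by blast
        qed
        then show "\<forall>\<^sub>F \<zeta> in tail_filter M. above_cut W x \<zeta>" unfolding ev using ar by blast
      qed
    qed
    then show ?thesis unfolding ev using c(1) by blast
  next
    case False
    have dom: "\<exists>a a'. (c, a) \<in> r \<and> (a, a') \<in> r \<and> dominates W (\<eta> a) (\<eta> a')"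
      if W: "W \<in> \<U>" and c: "c \<in> Field r" for W c
    proof (rule ccontr)
      assume contr: "\<not> ?thesis"
      obtain d where d: "d \<in> Field r"
        "\<And>a a'. (d, a) \<in> r \<Longrightarrow> (a, a') \<in> r \<Longrightarrow> (\<eta> a, \<eta> a') \<in> cut_entourage X \<U> W"
        using cauchy[OF W] by blast
      obtain e where e: "e \<in> Field r" "(c, e) \<in> r" "(d, e) \<in> r"
        using directed_preorder_upper_bound[OF dir c d(1)] .
      have "fst (\<eta> a') \<subseteq> fst (\<eta> a)" if "(e, a) \<in> r" "(a, a') \<in> r" for a a'
        using d(2)[OF tr[OF e(3) that(1)] that(2)] contr tr[OF e(2) that(1)] that(2)
        by (auto simp: cut_entourage_iff)
      with e(1) False show False by blast
    qed
    have "\<exists>Q :: ('i, 'a) net. tau_q_net X \<U> Q \<and> (\<forall>c\<in>Field r. \<forall>W\<in>\<U>.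
        \<forall>\<^sub>F x in tail_filter Q. \<exists>i j. (c, i) \<in> r \<and> (i, j) \<in> r \<and>
          below_cut W x (\<eta> i) \<and> above_cut W x (\<eta> j))"
    proof (rule diagonal_q_net[OF large qu dir])
      show "above_cut W x (\<eta> i)" if "V \<subseteq> W" "above_cut V x (\<eta> i)" for V W x i
        using above_cut_mono[OF that] .
      show "below_cut W x (\<eta> i)" if "V \<subseteq> W" "below_cut V x (\<eta> i)" for V W x i
        using below_cut_mono[OF that] .
    next
      fix W c assume W: "W \<in> \<U>" and c: "c \<in> Field r"
      obtain V where V: "V \<in> \<U>" "V O V O V \<subseteq> W" "V \<subseteq> W"
        using entourage_cube[OF qu W] by metis
      obtain d where d: "d \<in> Field r"
        "\<And>a a'. (d, a) \<in> r \<Longrightarrow> (a, a') \<in> r \<Longrightarrow> (\<eta> a, \<eta> a') \<in> cut_entourage X \<U> V"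
        using cauchy[OF V(1)] by blast
      obtain e where e: "e \<in> Field r" "(c, e) \<in> r" "(d, e) \<in> r"
        using directed_preorder_upper_bound[OF dir c d(1)] .
      obtain a a' where a: "(e, a) \<in> r" "(a, a') \<in> r" "dominates V (\<eta> a) (\<eta> a')"
        using dom[OF V(1) e(1)] by blast
      obtain b b' where b: "(a', b) \<in> r" "(b, b') \<in> r" "dominates V (\<eta> b) (\<eta> b')"
        using dom[OF V(1) FieldI2[OF a(2)]] by blast
      have "(\<eta> a', \<eta> b) \<in> cut_entourage X \<U> V"
        using d(2)[OF tr[OF tr[OF e(3) a(1)] a(2)] b(1)] .
      then obtain x where x: "x \<in> X" "below_cut V x (\<eta> a)" "above_cut (V O V O V) x (\<eta> b')"
        using interpolating_point[OF qu V(1) cut[OF FieldI2[OF a(1)]] cut[OF FieldI2[OF b(2)]] a(3) _ b(3)]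
        by blast
      have "below_cut W x (\<eta> a)" "above_cut W x (\<eta> b')"
        using below_cut_mono[OF V(3) x(2)] above_cut_mono[OF V(2) x(3)] by auto
      then show "\<exists>i j. \<exists>x\<in>X. (c, i) \<in> r \<and> (i, j) \<in> r \<and> below_cut W x (\<eta> i) \<and> above_cut W x (\<eta> j)"
        using x(1) tr[OF e(2) a(1)] tr[OF a(2) tr[OF b(1) b(2)]] by blast
    next
      fix W assume W: "W \<in> \<U>"
      obtain V where V: "V \<in> \<U>" "V O V O V \<subseteq> W" using entourage_cube[OF qu W] by metis
      obtain d where d: "d \<in> Field r"
        "\<And>a a'. (d, a) \<in> r \<Longrightarrow> (a, a') \<in> r \<Longrightarrow> (\<eta> a, \<eta> a') \<in> cut_entourage X \<U> V"
        using cauchy[OF V(1)] by blast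
      have "(x, y) \<in> W" if "(d, i) \<in> r" "(i, j) \<in> r" "above_cut V x (\<eta> i)" "below_cut V y (\<eta> j)"
        for i j x y
      proof -
        have "above_cut (V O V) x (\<eta> j)"
          using above_cut_entourage[OF qu V(1) d(2)[OF that(1,2)] that(3)] .
        then have "(x, y) \<in> (V O V) O V"
          using above_cut_below_cut_relcomp[OF cut[OF FieldI2[OF that(2)]] _ that(4)] by blast
        then show ?thesis using V(2) by (auto simp: O_assoc)
      qed
      then show "\<exists>V\<in>\<U>. \<exists>c\<in>Field r. \<forall>i j x y. (c, i) \<in> r \<longrightarrow> (i, j) \<in> r \<longrightarrow>
          above_cut V x (\<eta> i) \<longrightarrow> below_cut V y (\<eta> j) \<longrightarrow> (x, y) \<in> W"
        using V(1) d(1) by blast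
    qed
    then obtain Q :: "('i, 'a) net" where q: "tau_q_net X \<U> Q"
      and Q: "\<And>c W. c \<in> Field r \<Longrightarrow> W \<in> \<U> \<Longrightarrow> \<forall>\<^sub>F x in tail_filter Q.
        \<exists>i j. (c, i) \<in> r \<and> (i, j) \<in> r \<and> below_cut W x (\<eta> i) \<and> above_cut W x (\<eta> j)"
      by blast
    have lim: "q_limit X \<U> M Q"
      unfolding q_limit_def
    proof (intro conjI ballI)
      show "tau_q_net X \<U> Q" by (rule q)
      fix W assume W: "W \<in> \<U>"
      obtain V where V: "V \<in> \<U>" "V O V \<subseteq> W" using quasi_uniformityD(7)[OF qu W] by blast
      obtain d where d: "d \<in> Field r"
        "\<And>a a'. (d, a) \<in> r \<Longrightarrow> (a, a') \<in> r \<Longrightarrow> (\<eta> a, \<eta> a') \<in> cut_entourage X \<U> V"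
        using cauchy[OF V(1)] by blast
      show "\<forall>\<^sub>F x in tail_filter Q. \<forall>\<^sub>F \<zeta> in tail_filter M. above_cut W x \<zeta>"
        using Q[OF d(1) V(1)]
      proof (rule eventually_mono)
        fix x assume "\<exists>i j. (d, i) \<in> r \<and> (i, j) \<in> r \<and> below_cut V x (\<eta> i) \<and> above_cut V x (\<eta> j)"
        then obtain i j where j: "(d, i) \<in> r" "(i, j) \<in> r" "above_cut V x (\<eta> j)" by blast
        have "above_cut W x (\<eta> a)" if "(j, a) \<in> r" for a
          using above_cut_entourage[OF qu V(1) d(2)[OF tr[OF j(1,2)] that] j(3)]
          by (rule above_cut_mono[OF V(2)])
        then show "\<forall>\<^sub>F \<zeta> in tail_filter M. above_cut W x \<zeta>"
          unfolding ev using FieldI2[OF j(2)] by blast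
      qed
    qed
    have "\<forall>\<^sub>F \<zeta> in tail_filter M. \<forall>\<^sub>F x in tail_filter Q. below_cut U x \<zeta>"
    proof -
      obtain V where V: "V \<in> \<U>" "V O V \<subseteq> U" using quasi_uniformityD(7)[OF qu U] by blast
      obtain d where d: "d \<in> Field r"
        "\<And>a a'. (d, a) \<in> r \<Longrightarrow> (a, a') \<in> r \<Longrightarrow> (\<eta> a, \<eta> a') \<in> cut_entourage X \<U> V"
        using cauchy[OF V(1)] by blast
      have "\<forall>\<^sub>F x in tail_filter Q. below_cut U x (\<eta> a)" if a: "(d, a) \<in> r" for a
        using Q[OF FieldI2[OF a] V(1)]
      proof (rule eventually_mono)
        fix x assume "\<exists>i j. (a, i) \<in> r \<and> (i, j) \<in> r \<and> below_cut V x (\<eta> i) \<and> above_cut V x (\<eta> j)"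
        then obtain i where i: "(a, i) \<in> r" "below_cut V x (\<eta> i)" by blast
        show "below_cut U x (\<eta> a)"
          using below_cut_entourage[OF qu V(1) d(2)[OF a i(1)] i(2)]
          by (rule below_cut_mono[OF V(2)])
      qed
      then show ?thesis unfolding ev using d(1) by blast
    qed
    then show ?thesis by (rule eventually_mono) (use lim in blast)
  qed
qed

text \<open>
  A point of \<open>Q\<close> is above a late cut of \<open>M\<close>, which is close to a late cut of \<open>N\<close>, which is above a point
  of \<open>P\<close>. The tails of \<open>Q\<close> and \<open>P\<close> are chosen before the two cuts, hence jointly.
\<close>

lemma conet_limits:
  fixes M N :: "('j, ('i, 'a) cut) net"
  assumes M: "tau_q_net (tau_cuts X \<U>) (cut_uniformity X \<U>) M"
    and N: "tau_p_net (tau_cuts X \<U>) (cut_uniformity X \<U>) N"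
    and MN: "conet (cut_uniformity X \<U>) M N"
    and Q: "q_limit X \<U> M Q" and P: "p_limit X \<U> N P"
  shows "conet \<U> Q P"
  unfolding conet_def
proof
  fix W assume W: "W \<in> \<U>"
  obtain V where V: "V \<in> \<U>" "V O V O V \<subseteq> W" using entourage_cube[OF qu W] by metis
  have Vbar: "cut_entourage X \<U> V \<in> (cut_uniformity X \<U> :: (('i, 'a) cut \<times> _) set set)"
    by (rule cut_entourage_in_cut_uniformity[OF qu V(1)])
  note Mnet = tau_q_net_net_in[OF M] and Nnet = tau_p_net_net_in[OF N]
  have near: "\<forall>\<^sub>F \<eta> in tail_filter M. \<forall>\<^sub>F \<xi> in tail_filter N. (\<eta>, \<xi>) \<in> cut_entourage X \<U> V"
    using tau_in_eventually_eventually[OF Mnet Nnet] MN Vbar unfolding conet_def by blast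
  have xy: "(x, y) \<in> W"
    if x: "\<forall>\<^sub>F \<eta> in tail_filter M. above_cut V x \<eta>" and y: "\<forall>\<^sub>F \<xi> in tail_filter N. below_cut V y \<xi>"
    for x y
  proof -
    obtain \<eta> where \<eta>: "above_cut V x \<eta>" "\<forall>\<^sub>F \<xi> in tail_filter N. (\<eta>, \<xi>) \<in> cut_entourage X \<U> V"
      using eventually_happens'[OF tail_filter_neq_bot[OF Mnet] eventually_conj[OF x near]] by blast
    obtain \<xi> where \<xi>: "(\<eta>, \<xi>) \<in> cut_entourage X \<U> V" "below_cut V y \<xi>"
      using eventually_happens'[OF tail_filter_neq_bot[OF Nnet] eventually_conj[OF \<eta>(2) y]] by blast
    have "\<xi> \<in> tau_cuts X \<U>" using \<xi>(1) by (simp add: cut_entourage_iff)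
    then have "(x, y) \<in> (V O V) O V"
      using above_cut_below_cut_relcomp[OF _ above_cut_entourage[OF qu V(1) \<xi>(1) \<eta>(1)] \<xi>(2)] by blast
    then show ?thesis using V(2) by (auto simp: O_assoc)
  qed
  have "\<forall>\<^sub>F x in tail_filter Q. \<forall>\<^sub>F \<eta> in tail_filter M. above_cut V x \<eta>"
    "\<forall>\<^sub>F y in tail_filter P. \<forall>\<^sub>F \<xi> in tail_filter N. below_cut V y \<xi>"
    using Q P V(1) by (auto simp: q_limit_def p_limit_def)
  from eventually_prodI[OF this] have "\<forall>\<^sub>F z in tail_filter Q \<times>\<^sub>F tail_filter P. z \<in> W"
    by (rule eventually_mono) (metis prod.collapse xy)
  moreover have "net_in X Q" "net_in X P"
    using Q P unfolding q_limit_def p_limit_def by (blast intro: tau_q_net_net_in tau_p_net_net_in)+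
  ultimately show "tau_in Q P W" by (simp add: tau_in_iff_eventually)
qed

section \<open>Completeness of the complement\<close>

text \<open>
  The limit \<open>\<xi>\<close> is generated by the set \<open>T\<close> of all limits of nets in \<open>\<A>\<close>, so it plays the role of
  their supremum; the limits of nets in \<open>\<B>\<close> belong to its upper class. In both convergence proofs
  the alternative ``all nets of the late cut are limits'' gives an inclusion of lower classes and
  the alternative ``some limit is close to the late cut'' gives a domination through a point of that
  limit.
\<close>

lemma tau_complete_cut_uniformity:
  assumes large: "large_index_type TYPE('i) TYPE('a)"
  shows "tau_complete TYPE('j) (tau_cuts X \<U> :: ('i, 'a) cut set) (cut_uniformity X \<U>)"
  unfolding tau_complete_def
proof (intro allI impI)
  fix \<A> \<B> :: "('j, ('i, 'a) cut) net set"
  let ?Y = "tau_cuts X \<U> :: ('i, 'a) cut set"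
    and ?\<V> = "cut_uniformity X \<U> :: (('i, 'a) cut \<times> ('i, 'a) cut) set set"
  assume "tau_cut ?Y ?\<V> (\<A>, \<B>)"
  then have AB: "(\<A>, \<B>) \<in> tau_cuts ?Y ?\<V>" by (simp add: tau_cuts_def)
  have A: "tau_p_net ?Y ?\<V> N" if "N \<in> \<A>" for N using tau_cutsD(3)[OF AB] that by simp
  have B: "tau_q_net ?Y ?\<V> M" if "M \<in> \<B>" for M using tau_cutsD(4)[OF AB] that by simp
  have BA: "conet ?\<V> M N" if "M \<in> \<B>" "N \<in> \<A>" for M N using tau_cutsD(5)[OF AB] that by simp
  obtain U where U: "U \<in> \<U>" using quasi_uniformityD(2)[OF qu] by blast
  define T where "T = {P. \<exists>N\<in>\<A>. p_limit X \<U> N P}"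
  have T_conet: "conet \<U> Q P" if "M \<in> \<B>" "q_limit X \<U> M Q" "P \<in> T" for M Q P
    using conet_limits[OF B A BA] that unfolding T_def by blast
  have T_p: "tau_p_net X \<U> P" if "P \<in> T" for P using that by (auto simp: T_def p_limit_def)
  obtain N\<^sub>0 where N\<^sub>0: "N\<^sub>0 \<in> \<A>" using tau_cutsD(1)[OF AB] by auto
  have "\<exists>P. p_limit X \<U> N\<^sub>0 P"
  proof -
    have "\<forall>\<^sub>F \<zeta> in tail_filter N\<^sub>0. \<exists>P. p_limit X \<U> N\<^sub>0 P"
      using p_limits_of_cut_net[OF large A[OF N\<^sub>0] U] eventually_tail_filter_in[OF tau_p_net_net_in[OF A[OF N\<^sub>0]]]
      by eventually_elim (use tau_cutsD(1) in blast)
    then show ?thesis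
      using eventually_happens'[OF tail_filter_neq_bot[OF tau_p_net_net_in[OF A[OF N\<^sub>0]]]] by blast
  qed
  then have T_ne: "T \<noteq> {}" using N\<^sub>0 unfolding T_def by blast
  obtain M\<^sub>0 where M\<^sub>0: "M\<^sub>0 \<in> \<B>" using tau_cutsD(2)[OF AB] by auto
  have "\<exists>Q. q_limit X \<U> M\<^sub>0 Q"
  proof -
    have "\<forall>\<^sub>F \<zeta> in tail_filter M\<^sub>0. \<exists>Q. q_limit X \<U> M\<^sub>0 Q"
      using q_limits_of_cut_net[OF large B[OF M\<^sub>0] U] eventually_tail_filter_in[OF tau_q_net_net_in[OF B[OF M\<^sub>0]]]
      by eventually_elim (use tau_cutsD(2) in blast)
    then show ?thesis
      using eventually_happens'[OF tail_filter_neq_bot[OF tau_q_net_net_in[OF B[OF M\<^sub>0]]]] by blast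
  qed
  then obtain Q\<^sub>0 where Q\<^sub>0: "q_limit X \<U> M\<^sub>0 Q\<^sub>0" by blast
  then have "tau_q_net X \<U> Q\<^sub>0" by (simp add: q_limit_def)
  from tau_cut_generated[OF T_p T_ne this T_conet[OF M\<^sub>0 Q\<^sub>0]]
  obtain \<xi> where \<xi>: "\<xi> \<in> ?Y" "T \<subseteq> fst \<xi>"
    and snd_\<xi>: "snd \<xi> = {M. tau_q_net X \<U> M \<and> (\<forall>N\<in>T. conet \<U> M N)}" by blast
  have q_\<xi>: "Q \<in> snd \<xi>" if "M \<in> \<B>" "q_limit X \<U> M Q" for M Q
    unfolding snd_\<xi> using T_conet[OF that] that(2) by (simp add: q_limit_def)
  have "net_converges (qu_topology ?Y ?\<V>) N \<xi>" if N: "N \<in> \<A>" for N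
  proof (rule net_convergesI[OF quasi_uniformity_cut_uniformity[OF qu] \<xi>(1)])
    fix S assume "S \<in> ?\<V>"
    then obtain W where W: "W \<in> \<U>" "cut_entourage X \<U> W \<subseteq> S" using cut_uniformity_iff[OF qu] by blast
    obtain V where V: "V \<in> \<U>" "V O V \<subseteq> W" using quasi_uniformityD(7)[OF qu W(1)] by blast
    have near: "(\<xi>, \<zeta>) \<in> cut_entourage X \<U> W" if \<zeta>: "\<zeta> \<in> ?Y"
      and lim: "(\<forall>P\<in>fst \<zeta>. p_limit X \<U> N P) \<or>
        (\<exists>P. p_limit X \<U> N P \<and> (\<forall>\<^sub>F x in tail_filter P. above_cut V x \<zeta>))" for \<zeta>
      using lim
    proof
      assume "\<forall>P\<in>fst \<zeta>. p_limit X \<U> N P"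
      then have "fst \<zeta> \<subseteq> T" using N unfolding T_def by blast
      then have "fst \<zeta> \<subseteq> fst \<xi>" using \<xi>(2) by (rule order_trans)
      then show ?thesis using \<zeta> \<xi>(1) by (simp add: cut_entourage_iff)
    next
      assume "\<exists>P. p_limit X \<U> N P \<and> (\<forall>\<^sub>F x in tail_filter P. above_cut V x \<zeta>)"
      then obtain P where P: "p_limit X \<U> N P" "\<forall>\<^sub>F x in tail_filter P. above_cut V x \<zeta>" by blast
      have PT: "P \<in> T" using P(1) N unfolding T_def by blast
      obtain x where x: "\<forall>\<^sub>F y in tail_filter P. (y, x) \<in> V" "above_cut V x \<zeta>"
        using eventually_happens'[OF tail_filter_neq_bot[OF tau_p_net_net_in[OF T_p[OF PT]]]
            eventually_conj[OF eventually_tail_p_net[OF T_p[OF PT] V(1)] P(2)]] by blast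
      have "below_cut V x \<xi>" using below_cutI[OF _ x(1)] PT \<xi>(2) by blast
      then have "dominates W \<xi> \<zeta>"
        using dominates_mono[OF V(2)] dominates_through_point[OF \<xi>(1) \<zeta> _ x(2)] by blast
      then show ?thesis using \<zeta> \<xi>(1) by (simp add: cut_entourage_iff)
    qed
    from p_limits_of_cut_net[OF large A[OF N] V(1)] eventually_tail_filter_in[OF tau_p_net_net_in[OF A[OF N]]]
    show "\<forall>\<^sub>F \<zeta> in tail_filter N. (\<xi>, \<zeta>) \<in> S" by eventually_elim (use near W(2) in blast)
  qed
  moreover have "net_converges (qu_topology ?Y (conjugate ?\<V>)) M \<xi>" if M: "M \<in> \<B>" for M
  proof (rule net_convergesI[OF quasi_uniformity_conjugate[OF quasi_uniformity_cut_uniformity[OF qu]] \<xi>(1)])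
    fix S' assume "S' \<in> conjugate ?\<V>"
    then obtain S where S: "S \<in> ?\<V>" "S' = S\<inverse>" by (auto simp: conjugate_def)
    then obtain W where W: "W \<in> \<U>" "cut_entourage X \<U> W \<subseteq> S" using cut_uniformity_iff[OF qu] by blast
    obtain V where V: "V \<in> \<U>" "V O V O V \<subseteq> W" using entourage_cube[OF qu W(1)] by metis
    have near: "(\<zeta>, \<xi>) \<in> cut_entourage X \<U> W" if \<zeta>: "\<zeta> \<in> ?Y"
      and lim: "(\<forall>Q\<in>snd \<zeta>. q_limit X \<U> M Q) \<or>
        (\<exists>Q. q_limit X \<U> M Q \<and> (\<forall>\<^sub>F x in tail_filter Q. below_cut V x \<zeta>))" for \<zeta>
      using lim
    proof
      assume "\<forall>Q\<in>snd \<zeta>. q_limit X \<U> M Q"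
      then have "\<And>Q. Q \<in> snd \<zeta> \<Longrightarrow> Q \<in> snd \<xi>" using q_\<xi>[OF M] by blast
      then have "N \<in> fst \<zeta>" if "N \<in> fst \<xi>" for N
        using tau_cutsD(7)[OF \<zeta>] tau_cutsD(3,5)[OF \<xi>(1)] that by blast
      then show ?thesis using \<zeta> \<xi>(1) by (simp add: cut_entourage_iff subsetI)
    next
      assume "\<exists>Q. q_limit X \<U> M Q \<and> (\<forall>\<^sub>F x in tail_filter Q. below_cut V x \<zeta>)"
      then obtain Q where Q: "q_limit X \<U> M Q" "\<forall>\<^sub>F x in tail_filter Q. below_cut V x \<zeta>" by blast
      have q: "tau_q_net X \<U> Q" using Q(1) by (simp add: q_limit_def)
      obtain x where x: "\<forall>\<^sub>F y in tail_filter Q. (x, y) \<in> V" "below_cut V x \<zeta>"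
        using eventually_happens'[OF tail_filter_neq_bot[OF tau_q_net_net_in[OF q]]
            eventually_conj[OF eventually_tail_q_net[OF q V(1)] Q(2)]] by blast
      have "above_cut (V O V) x \<xi>" by (rule above_cut_q_net[OF qu \<xi>(1) q_\<xi>[OF M Q(1)] V(1) x(1)])
      then have "dominates W \<zeta> \<xi>"
        using dominates_mono[OF V(2)] dominates_through_point[OF \<zeta> \<xi>(1) x(2)] by blast
      then show ?thesis using \<zeta> \<xi>(1) by (simp add: cut_entourage_iff)
    qed
    from q_limits_of_cut_net[OF large B[OF M] V(1)] eventually_tail_filter_in[OF tau_q_net_net_in[OF B[OF M]]]
    show "\<forall>\<^sub>F \<zeta> in tail_filter M. (\<xi>, \<zeta>) \<in> S'" unfolding S(2) by eventually_elim (use near W(2) in blast)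
  qed
  ultimately show "\<exists>p\<in>?Y. (\<forall>N\<in>\<A>. net_converges (qu_topology ?Y ?\<V>) N p) \<and>
      (\<forall>M\<in>\<B>. net_converges (qu_topology ?Y (conjugate ?\<V>)) M p)"
    using \<xi>(1) by blast
qed

end

theorem theorem28:
  fixes X :: "'a set" and \<U> :: "('a \<times> 'a) set set"
  assumes "quasi_uniformity X \<U>"
    and "t0_space (qu_topology X \<U>)"
    and "large_index_type TYPE('i) TYPE('a)"
  shows "quasi_uniformity (tau_cuts X \<U> :: ('i, 'a) cut set) (cut_uniformity X \<U>) \<and>
         tau_complete TYPE('j) (tau_cuts X \<U> :: ('i, 'a) cut set) (cut_uniformity X \<U>)"
  using quasi_uniformity_cut_uniformity[OF assms(1)] tau_complete_cut_uniformity[OF assms(1,3)]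
  by (rule conjI)

end
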